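(* Let $\omega_{FS}\in\Omega^2(\mathbb{C}\mathrm{P}^n)$ be the Fubini--Study form normalized such that the generator of $H_2(\mathbb{C}\mathrm{P}^n,\mathbb{Z})$ has area $4\pi$. Then there is an $\mathrm{SO}(n+1)$-equivariant symplectomorphism $$F:(D_1\mathbb{R}\mathrm{P}^n,\mathrm{d}\lambda)\to(\mathbb{C}\mathrm{P}^n\setminus Q^{n-1},\omega_{FS}),$$ where $Q^{n-1}\subset\mathbb{C}\mathrm{P}^n$ denotes the quadric $$Q^{n-1}:=\{[z_0:\ldots:z_n] : z_0^2+\ldots+z_n^2=0\}\subset\mathbb{C}\mathrm{P}^n.$$
   Context: Here $n\ge1$ is any integer. The Fubini--Study metric on $\mathbb{C}\mathrm{P}^n$ is the one compatible with $\omega_{FS}$: $g(j\cdot,\cdot)=\omega_{FS}(\cdot,\cdot)$, with $j$ the standard complex structure. $\mathbb{R}\mathrm{P}^n\subset\mathbb{C}\mathrm{P}^n$ (real points) carries the round metric $g$ induced from this Fubini--Study metric, so that its prime (simple closed) geodesics have length $2\pi$. Let $\pi:T\mathbb{R}\mathrm{P}^n\to\mathbb{R}\mathrm{P}^n$ be the footpoint projection and let $\lambda$ be the pullback to $T\mathbb{R}\mathrm{P}^n$ of the canonical 1-form on $T^*\mathbb{R}\mathrm{P}^n$ via the metric isomorphism, $\lambda_{(x,v)}(\xi)=g_x(v,\mathrm{d}\pi_{(x,v)}(\xi))$. $D_1\mathbb{R}\mathrm{P}^n=\{(x,v)\in T\mathbb{R}\mathrm{P}^n: g_x(v,v)<1\}$.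 $\mathrm{SO}(n+1)$ acts on $\mathbb{R}\mathrm{P}^n$ in the standard way by isometries and on $T\mathbb{R}\mathrm{P}^n$ by the induced (differential) action; on $\mathbb{C}\mathrm{P}^n$ it acts as the subgroup $\mathrm{SO}(n+1)\subset\mathrm{SU}(n+1)$ of the standard action. *)

theory Defs
  imports "HOL-Analysis.Analysis"
begin

section \<open>Smooth maps between normed spaces\<close>

text \<open>Intended for open S in finite-dimensional spaces, where it is the class of C-k maps.\<close>

primrec Ck_on :: "nat \<Rightarrow> 'a::real_normed_vector set \<Rightarrow> ('a \<Rightarrow> 'b::real_normed_vector) \<Rightarrow> bool" where
  "Ck_on 0 S f \<longleftrightarrow> continuous_on S f"
| "Ck_on (Suc k) S f \<longleftrightarrow>
     f differentiable_on S \<and> (\<forall>v. Ck_on k S (\<lambda>x. frechet_derivative f (at x) v))"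

definition smooth_on :: "'a::real_normed_vector set \<Rightarrow> ('a \<Rightarrow> 'b::real_normed_vector) \<Rightarrow> bool" where
  "smooth_on S f \<longleftrightarrow> (\<forall>k. Ck_on k S f)"


section \<open>Manifolds given by an indexed atlas\<close>

text \<open>The manifold has points of type 'p, charts indexed by 'i and model space 'e. The record
  only carries data; the constructions below are meant for smoothly compatible
  charts with open images.\<close>

record ('p, 'i, 'e) mfd =
  chart_dom :: "'i \<Rightarrow> 'p set"
  chart :: "'i \<Rightarrow> 'p \<Rightarrow> 'e"

definition points :: "('p, 'i, 'e) mfd \<Rightarrow> 'p set" where
  "points M = (\<Union>i. chart_dom M i)"

definition chart_inv :: "('p, 'i, 'e) mfd \<Rightarrow> 'i \<Rightarrow> 'e \<Rightarrow> 'p" where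
  "chart_inv M i = inv_into (chart_dom M i) (chart M i)"

definition chart_at :: "('p, 'i, 'e) mfd \<Rightarrow> 'p \<Rightarrow> 'i" where
  "chart_at M p = (SOME i. p \<in> chart_dom M i)"

definition restrict_mfd :: "('p, 'i, 'e) mfd \<Rightarrow> 'p set \<Rightarrow> ('p, 'i, 'e) mfd" where
  "restrict_mfd M S = \<lparr>chart_dom = (\<lambda>i. chart_dom M i \<inter> S), chart = chart M\<rparr>"

definition open_mfd :: "'e set \<Rightarrow> ('e, unit, 'e) mfd" where
  "open_mfd U = \<lparr>chart_dom = (\<lambda>_. U), chart = (\<lambda>_ x. x)\<rparr>"

text \<open>Smoothness contains continuity through openness of the domains of all local
  representatives.\<close>

definition smooth_map ::
  "('p, 'i, 'e::euclidean_space) mfd \<Rightarrow> ('q, 'j, 'f::euclidean_space) mfd \<Rightarrow> ('p \<Rightarrow> 'q) \<Rightarrow> bool" where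
  "smooth_map M N f \<longleftrightarrow>
     f ` points M \<subseteq> points N \<and>
     (\<forall>i j. let U = chart M i ` {p \<in> chart_dom M i. f p \<in> chart_dom N j}
            in open U \<and> smooth_on U (chart N j \<circ> f \<circ> chart_inv M i))"

definition diffeomorphism ::
  "('p, 'i, 'e::euclidean_space) mfd \<Rightarrow> ('q, 'j, 'f::euclidean_space) mfd \<Rightarrow> ('p \<Rightarrow> 'q) \<Rightarrow> bool" where
  "diffeomorphism M N f \<longleftrightarrow>
     bij_betw f (points M) (points N) \<and> smooth_map M N f \<and>
     smooth_map N M (inv_into (points M) f)"

text \<open>A tangent vector at p is the family of its coordinate vectors in all charts around p, related
  by the differentials of the transition maps; components at the other charts are 0 by convention.\<close>

definition tangent_space :: "('p, 'i, 'e::euclidean_space) mfd \<Rightarrow> 'p \<Rightarrow> ('i \<Rightarrow> 'e) set" where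
  "tangent_space M p =
     {v. (\<forall>i j. p \<in> chart_dom M i \<longrightarrow> p \<in> chart_dom M j \<longrightarrow>
            v j = frechet_derivative (chart M j \<circ> chart_inv M i) (at (chart M i p)) (v i)) \<and>
         (\<forall>i. p \<notin> chart_dom M i \<longrightarrow> v i = 0)}"

definition tangent_bundle ::
  "('p, 'i, 'e::euclidean_space) mfd \<Rightarrow> ('p \<times> ('i \<Rightarrow> 'e), 'i, 'e \<times> 'e) mfd" where
  "tangent_bundle M =
     \<lparr>chart_dom = (\<lambda>i. {(p, v). p \<in> chart_dom M i \<and> v \<in> tangent_space M p}),
      chart = (\<lambda>i (p, v). (chart M i p, v i))\<rparr>"

definition differential ::
  "('p, 'i, 'e::euclidean_space) mfd \<Rightarrow> ('q, 'j, 'f::euclidean_space) mfd \<Rightarrow> ('p \<Rightarrow> 'q) \<Rightarrow>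
   'p \<Rightarrow> ('i \<Rightarrow> 'e) \<Rightarrow> ('j \<Rightarrow> 'f)" where
  "differential M N f p v =
     (let i = chart_at M p in
      (\<lambda>j. if f p \<in> chart_dom N j
           then frechet_derivative (chart N j \<circ> f \<circ> chart_inv M i) (at (chart M i p)) (v i)
           else 0))"

text \<open>The tangent vector at p whose component in chart i is u.\<close>

definition tangent_of :: "('p, 'i, 'e::euclidean_space) mfd \<Rightarrow> 'i \<Rightarrow> 'p \<Rightarrow> 'e \<Rightarrow> ('i \<Rightarrow> 'e)" where
  "tangent_of M i p u = (THE v. v \<in> tangent_space M p \<and> v i = u)"


section \<open>Differential forms\<close>

text \<open>Forms are only meaningful on tangent vectors of the manifold.\<close>

type_synonym ('p, 'i, 'e) one_form = "'p \<Rightarrow> ('i \<Rightarrow> 'e) \<Rightarrow> real"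
type_synonym ('p, 'i, 'e) two_tensor = "'p \<Rightarrow> ('i \<Rightarrow> 'e) \<Rightarrow> ('i \<Rightarrow> 'e) \<Rightarrow> real"

text \<open>In coordinates, the exterior derivative of \<open>\<lambda>\<close> is \<open>(v, w) \<mapsto> D\<^sub>v (\<lambda> w) - D\<^sub>w (\<lambda> v)\<close>
  for constant v and w.\<close>

definition ext_deriv ::
  "('p, 'i, 'e::euclidean_space) mfd \<Rightarrow> ('p, 'i, 'e) one_form \<Rightarrow> ('p, 'i, 'e) two_tensor" where
  "ext_deriv M \<theta> p v w =
     (let i = chart_at M p;
          \<theta>\<^sub>i = (\<lambda>u x. \<theta> (chart_inv M i x) (tangent_of M i (chart_inv M i x) u))
      in frechet_derivative (\<theta>\<^sub>i (w i)) (at (chart M i p)) (v i)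
       - frechet_derivative (\<theta>\<^sub>i (v i)) (at (chart M i p)) (w i))"

definition symplectomorphism ::
  "('p, 'i, 'e::euclidean_space) mfd \<Rightarrow> ('p, 'i, 'e) two_tensor \<Rightarrow>
   ('q, 'j, 'f::euclidean_space) mfd \<Rightarrow> ('q, 'j, 'f) two_tensor \<Rightarrow> ('p \<Rightarrow> 'q) \<Rightarrow> bool" where
  "symplectomorphism M \<omega> N \<omega>' f \<longleftrightarrow>
     diffeomorphism M N f \<and>
     (\<forall>p \<in> points M. \<forall>v \<in> tangent_space M p. \<forall>w \<in> tangent_space M p.
        \<omega>' (f p) (differential M N f p v) (differential M N f p w) = \<omega> p v w)"

definition canonical_one_form ::
  "('p, 'i, 'e::euclidean_space) mfd \<Rightarrow> ('p, 'i, 'e) two_tensor \<Rightarrow>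
   ('p \<times> ('i \<Rightarrow> 'e), 'i, 'e \<times> 'e) one_form" where
  "canonical_one_form M g = (\<lambda>(x, v) \<xi>. g x v (differential (tangent_bundle M) M fst (x, v) \<xi>))"

definition unit_disc_bundle ::
  "('p, 'i, 'e::euclidean_space) mfd \<Rightarrow> ('p, 'i, 'e) two_tensor \<Rightarrow>
   ('p \<times> ('i \<Rightarrow> 'e), 'i, 'e \<times> 'e) mfd" where
  "unit_disc_bundle M g = restrict_mfd (tangent_bundle M) {(x, v). g x v v < 1}"


section \<open>Projective spaces\<close>

text \<open>With \<open>n = CARD('n) \<ge> 1\<close>, the index type \<open>'n option\<close> has n + 1 elements. Projective n-space
  over a field is the set of lines through 0 in the (n + 1)-dimensional space. The i-th affine chart
  has coordinates \<open>z\<^sub>j / z\<^sub>i\<close> for \<open>j \<noteq> i\<close>; the map \<open>skip i\<close> is a bijection from \<open>'n\<close> onto the indices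
  different from i.\<close>

definition skip :: "'n option \<Rightarrow> 'n \<Rightarrow> 'n option" where
  "skip i k = (if i = Some k then None else Some k)"

definition line :: "'k::field ^ 'm \<Rightarrow> ('k ^ 'm) set" where
  "line z = vec.span {z}"

definition affine_rep :: "'m \<Rightarrow> ('k::field ^ 'm) set \<Rightarrow> 'k ^ 'm" where
  "affine_rep i L = (THE z. z \<in> L \<and> z $ i = 1)"

definition proj_space :: "(('k::field ^ 'n option) set, 'n::finite option, 'k ^ 'n) mfd" where
  "proj_space =
     \<lparr>chart_dom = (\<lambda>i. {line z | z. z $ i \<noteq> 0}),
      chart = (\<lambda>i L. \<chi> k. affine_rep i L $ skip i k)\<rparr>"

abbreviation RP :: "((real ^ 'n option) set, 'n::finite option, real ^ 'n) mfd" where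
  "RP \<equiv> proj_space"

abbreviation CP :: "((complex ^ 'n option) set, 'n::finite option, complex ^ 'n) mfd" where
  "CP \<equiv> proj_space"

text \<open>The inclusion of the real points.\<close>

definition RP_to_CP :: "(real ^ 'n option) set \<Rightarrow> (complex ^ 'n::finite option) set" where
  "RP_to_CP L = vec.span ((\<lambda>x. \<chi> i. complex_of_real (x $ i)) ` L)"

definition quadric :: "(complex ^ 'n::finite option) set set" where
  "quadric = {line z | z. z \<noteq> 0 \<and> (\<Sum>i\<in>UNIV. (z $ i)\<^sup>2) = 0}"


section \<open>Fubini--Study form and metric\<close>

definition herm :: "complex ^ 'm \<Rightarrow> complex ^ 'm::finite \<Rightarrow> complex" where
  "herm u w = (\<Sum>i\<in>UNIV. cnj (u $ i) * w $ i)"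

text \<open>The differential at z of the projection \<open>\<complex>\<^bsup>n+1\<^esup> - {0} \<rightarrow> CP\<^bsup>n\<^esup>\<close>.\<close>

definition dproj :: "complex ^ 'n option \<Rightarrow> complex ^ 'n option \<Rightarrow> ('n::finite option \<Rightarrow> complex ^ 'n)" where
  "dproj z u = differential (open_mfd (- {0})) CP line z (\<lambda>_. u)"

text \<open>The form whose pullback to \<open>\<complex>\<^bsup>n+1\<^esup> - {0}\<close> is c times \<open>(\<i>/2) \<partial>\<partial>\<^sup>* log |z|\<^sup>2\<close>, where
  \<open>\<partial>\<^sup>*\<close> is the antiholomorphic Dolbeault operator. The value does not depend on the lifts z, u, w
  of p, v, v'. The scale c is left open.\<close>

definition fs_form ::
  "real \<Rightarrow> ((complex ^ 'n option) set, 'n::finite option, complex ^ 'n) two_tensor" where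
  "fs_form c p v v' =
     (THE r. \<exists>z u w. z \<noteq> 0 \<and> p = line z \<and> v = dproj z u \<and> v' = dproj z w \<and>
        r = c * Im (herm z z * herm u w - herm u z * herm z w) / (norm z) ^ 4)"

text \<open>The area of the projective line
  \<open>{[z\<^sub>0 : \<dots> : z\<^sub>n]. z\<^sub>j = 0 for all j other than None and Some k}\<close>, which represents the positive
  generator of the second homology group. The line is parametrized by \<open>\<complex>\<close> up to one point.\<close>

definition coord_line :: "'n \<Rightarrow> complex \<Rightarrow> (complex ^ 'n::finite option) set" where
  "coord_line k \<zeta> = line (axis None 1 + \<zeta> *s axis (Some k) 1)"

definition line_area ::
  "((complex ^ 'n option) set, 'n::finite option, complex ^ 'n) two_tensor \<Rightarrow> 'n \<Rightarrow> real" where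
  "line_area \<omega> k =
     (LINT \<zeta>|lborel.
        \<omega> (coord_line k \<zeta>)
          (differential (open_mfd UNIV) CP (coord_line k) \<zeta> (\<lambda>_. 1))
          (differential (open_mfd UNIV) CP (coord_line k) \<zeta> (\<lambda>_. \<i>)))"

text \<open>The standard complex structure: the affine charts are holomorphic.\<close>

definition CP_J :: "('n::finite option \<Rightarrow> complex ^ 'n) \<Rightarrow> ('n option \<Rightarrow> complex ^ 'n)" where
  "CP_J v = (\<lambda>i. \<i> *s v i)"

text \<open>The metric g with \<open>g (J v) w = \<omega> v w\<close>, that is \<open>g v w = \<omega> (- J v) w\<close>.\<close>

definition fs_metric ::
  "real \<Rightarrow> ((complex ^ 'n option) set, 'n::finite option, complex ^ 'n) two_tensor" where
  "fs_metric c p v w = fs_form c p (\<lambda>i. - CP_J v i) w"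

definition RP_metric ::
  "real \<Rightarrow> ((real ^ 'n option) set, 'n::finite option, real ^ 'n) two_tensor" where
  "RP_metric c p v w =
     fs_metric c (RP_to_CP p) (differential RP CP RP_to_CP p v) (differential RP CP RP_to_CP p w)"


section \<open>The actions of SO(n+1)\<close>

definition act_RP :: "real ^ 'n option ^ 'n option \<Rightarrow> (real ^ 'n option) set \<Rightarrow> (real ^ 'n::finite option) set" where
  "act_RP A L = (\<lambda>x. A *v x) ` L"

definition act_TRP ::
  "real ^ 'n option ^ 'n option \<Rightarrow> (real ^ 'n option) set \<times> ('n option \<Rightarrow> real ^ 'n) \<Rightarrow>
   (real ^ 'n option) set \<times> ('n::finite option \<Rightarrow> real ^ 'n)" where
  "act_TRP A = (\<lambda>(p, v). (act_RP A p, differential RP RP (act_RP A) p v))"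

definition act_CP :: "real ^ 'n option ^ 'n option \<Rightarrow> (complex ^ 'n option) set \<Rightarrow> (complex ^ 'n::finite option) set" where
  "act_CP A L = (\<lambda>z. map_matrix complex_of_real A *v z) ` L"

end

theory Submission
  imports Defs "HOL-Real_Asymp.Real_Asymp"
begin

text \<open>
  Write a tangent vector of \<open>RP\<^sup>n\<close> at the line through \<open>x \<noteq> 0\<close> as the image of some vector u under the
  differential at x of the projection onto lines. Put \<open>s = x / \<bar>x\<bar>\<close> and let \<open>h\<close> be the image of u under the
  derivative of \<open>x \<mapsto> x / \<bar>x\<bar>\<close>, so that \<open>h \<bottom> s\<close>; up to a common sign, s and h depend only on the tangent
  vector. The area of a projective line for \<^term>\<open>fs_form c\<close> is \<open>c \<pi>\<close> (\<open>line_area_fs_form\<close>), so the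
  normalization says \<open>c = 4\<close>. Then the squared length of the tangent vector is \<open>4 \<bar>h\<bar>\<^sup>2\<close> and the
  canonical 1-form is \<open>4 h \<cdot> ds\<close>. On the unit sphere of \<open>\<complex>\<^bsup>n+1\<^esup>\<close> the Fubini--Study form lifts to
  \<open>4 \<Sum> d(Re z\<^sub>j) \<and> d(Im z\<^sub>j)\<close>, the exterior derivative of \<open>-4 Im z \<cdot> d(Re z)\<close>. For
  \<open>z = f s - \<i> h / f\<close>, with f a function of \<open>\<bar>h\<bar>\<close>, the pullback of this primitive is
  \<open>4 h \<cdot> ds + 4 (df / f) (h \<cdot> s) = 4 h \<cdot> ds\<close>, the canonical 1-form. It remains to have \<open>\<bar>z\<bar> = 1\<close>,
  which reads \<open>f\<^sup>2 + \<bar>h\<bar>\<^sup>2 / f\<^sup>2 = 1\<close> and is solved by \<open>f\<^sup>2 = (1 + sqrt (1 - 4 \<bar>h\<bar>\<^sup>2)) / 2\<close> on the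
  disc bundle \<open>4 \<bar>h\<bar>\<^sup>2 < 1\<close>. This is the map \<open>polar_lift\<close>, and the symplectomorphism sends the tangent
  vector to the line through z (\<open>disc_map_symplectic\<close>).

  Since \<open>\<Sum> z\<^sub>j\<^sup>2 = f\<^sup>2 - \<bar>h\<bar>\<^sup>2 / f\<^sup>2 = sqrt (1 - 4 \<bar>h\<bar>\<^sup>2) > 0\<close>, the image avoids the quadric. Conversely, a
  line off the quadric contains a unit vector z with \<open>\<Sum> z\<^sub>j\<^sup>2 > 0\<close>, unique up to sign; its real and
  imaginary parts are orthogonal, the real part is the longer one, and s, f and h can be read off
  (\<open>polar_lift_of_cplx\<close>, \<open>inj_on_disc_map\<close>). The choice of the phase can be made smoothly in z near any
  given point (\<open>inverse_lift\<close>), so the inverse is smooth. Orthogonal matrices preserve all the data in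
  the formula for z, whence the equivariance.

  All manifolds involved are images of open subsets of Euclidean spaces: \<open>RP\<^sup>n\<close> and \<open>CP\<^sup>n\<close> of the nonzero
  vectors, their tangent bundles and open subsets accordingly. The locale \<open>smooth_cover\<close> says what is
  required of such a presentation to express smoothness, differentials and exterior derivatives by lifts,
  so that all computations take place in homogeneous coordinates.
\<close>

section \<open>Calculus of smooth maps\<close>

lemma Ck_on_cong:
  assumes "open S" "\<And>x. x \<in> S \<Longrightarrow> f x = g x" "Ck_on k S f"
  shows "Ck_on k S g"
  using assms(2,3)
proof (induction k arbitrary: f g)
  case 0
  then show ?case by (simp cong: continuous_on_cong)
next
  case (Suc k)
  have d: "g differentiable_on S"
    using Suc.prems by (auto simp: differentiable_on_def intro: differentiable_transform_within[of _ _ _ 1])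
  have e: "frechet_derivative f (at x) = frechet_derivative g (at x)" if "x \<in> S" for x
    by (rule frechet_derivative_transform_within_open[OF _ assms(1) that Suc.prems(1)])
      (use Suc.prems that assms(1) in \<open>auto simp: differentiable_on_eq_differentiable_at\<close>)
  have "Ck_on k S (\<lambda>x. frechet_derivative g (at x) v)" for v
    by (rule Suc.IH[of "\<lambda>x. frechet_derivative f (at x) v"]) (use Suc.prems e in auto)
  with d show ?case by simp
qed

lemma Ck_on_subset: "Ck_on k S f \<Longrightarrow> T \<subseteq> S \<Longrightarrow> Ck_on k T f"
  by (induction k arbitrary: f) (auto intro: continuous_on_subset differentiable_on_subset)

text \<open>Smoothness has to be checked locally because local representatives of maps between manifolds and local
  lifts are only available on small open sets.\<close>

lemma Ck_on_locally:
  assumes "\<And>x. x \<in> S \<Longrightarrow> \<exists>T. open T \<and> x \<in> T \<and> Ck_on k T f"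
  shows "Ck_on k S f"
  using assms
proof (induction k arbitrary: f)
  case 0
  have "continuous (at x within S) f" if "x \<in> S" for x
  proof -
    obtain T where "open T" "x \<in> T" "continuous_on T f" using "0.prems"[OF \<open>x \<in> S\<close>] by auto
    then show ?thesis
      by (meson continuous_on_eq_continuous_at continuous_at_imp_continuous_at_within)
  qed
  then show ?case by (simp add: continuous_on_eq_continuous_within)
next
  case (Suc k)
  have "f differentiable (at x within S)" if "x \<in> S" for x
  proof -
    obtain T where "open T" "x \<in> T" "f differentiable_on T" using Suc.prems[OF \<open>x \<in> S\<close>] by auto
    then show ?thesis
      by (meson differentiable_on_eq_differentiable_at differentiable_at_withinI)
  qed
  moreover have "Ck_on k S (\<lambda>x. frechet_derivative f (at x) v)" for v
  proof (rule Suc.IH)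
    fix x assume "x \<in> S"
    from Suc.prems[OF this] show "\<exists>T. open T \<and> x \<in> T \<and> Ck_on k T (\<lambda>x. frechet_derivative f (at x) v)"
      by auto
  qed
  ultimately show ?case by (simp add: differentiable_on_def)
qed

text \<open>The form in which the class is established by induction: any family of derivatives will do.\<close>

lemma Ck_on_has_derivativeI:
  assumes "open S" "\<And>x. x \<in> S \<Longrightarrow> (f has_derivative D x) (at x)"
    and "\<And>v. Ck_on k S (\<lambda>x. D x v)"
  shows "Ck_on (Suc k) S f"
proof -
  have "frechet_derivative f (at x) = D x" if "x \<in> S" for x
    using frechet_derivative_at[OF assms(2)[OF that]] by simp
  then have "Ck_on k S (\<lambda>x. frechet_derivative f (at x) v)" for v
    by (intro Ck_on_cong[OF assms(1) _ assms(3)[of v]]) simp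
  moreover have "f differentiable_on S"
    using assms(1,2) by (auto simp: differentiable_on_eq_differentiable_at differentiable_def)
  ultimately show ?thesis by simp
qed

lemma Ck_on_Suc_imp_Ck_on: "Ck_on (Suc k) S f \<Longrightarrow> Ck_on k S f"
proof (induction k arbitrary: f)
  case 0
  then show ?case by (auto intro: differentiable_imp_continuous_on)
next
  case (Suc k)
  then have "f differentiable_on S" "\<And>v. Ck_on (Suc k) S (\<lambda>x. frechet_derivative f (at x) v)"
    by simp_all
  then show ?case using Suc.IH by auto
qed

lemma Ck_on_Suc_has_derivative:
  assumes "open S" "Ck_on (Suc k) S f" "x \<in> S"
  shows "(f has_derivative frechet_derivative f (at x)) (at x)"
  using assms by (simp add: differentiable_on_eq_differentiable_at frechet_derivative_works)

lemma Ck_on_const: "open S \<Longrightarrow> Ck_on k S (\<lambda>x. c)"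
proof (induction k arbitrary: c)
  case 0
  then show ?case by simp
next
  case (Suc k)
  then show ?case by (intro Ck_on_has_derivativeI[where D = "\<lambda>_ _. 0"]) auto
qed

lemma Ck_on_linear_compose:
  assumes "open S" "bounded_linear h" "Ck_on k S f"
  shows "Ck_on k S (\<lambda>x. h (f x))"
  using assms(3)
proof (induction k arbitrary: f)
  case 0
  then show ?case using assms(2) by (simp add: bounded_linear.continuous_on)
next
  case (Suc k)
  show ?case
  proof (rule Ck_on_has_derivativeI[OF assms(1)])
    show "((\<lambda>x. h (f x)) has_derivative (\<lambda>v. h (frechet_derivative f (at x) v))) (at x)"
      if "x \<in> S" for x
      by (rule bounded_linear.has_derivative[OF assms(2) Ck_on_Suc_has_derivative[OF assms(1) Suc.prems that]])
    show "Ck_on k S (\<lambda>x. h (frechet_derivative f (at x) v))" for v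
      using Suc by simp
  qed
qed

lemma Ck_on_ident: "open S \<Longrightarrow> Ck_on k S (\<lambda>x. x)"
proof (cases k)
  case (Suc j)
  assume "open S"
  then show ?thesis unfolding Suc
    by (intro Ck_on_has_derivativeI[where D = "\<lambda>_ v. v"]) (auto intro: Ck_on_const)
qed simp

lemma Ck_on_add:
  assumes "open S" "Ck_on k S f" "Ck_on k S g"
  shows "Ck_on k S (\<lambda>x. f x + g x)"
  using assms(2,3)
proof (induction k arbitrary: f g)
  case 0
  then show ?case by (simp add: continuous_on_add)
next
  case (Suc k)
  show ?case
  proof (rule Ck_on_has_derivativeI[OF assms(1)])
    show "((\<lambda>x. f x + g x) has_derivative
        (\<lambda>v. frechet_derivative f (at x) v + frechet_derivative g (at x) v)) (at x)" if "x \<in> S" for x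
      using Suc.prems that assms(1) by (intro has_derivative_add Ck_on_Suc_has_derivative) auto
    show "Ck_on k S (\<lambda>x. frechet_derivative f (at x) v + frechet_derivative g (at x) v)" for v
      using Suc.prems by (intro Suc.IH) simp_all
  qed
qed

lemma Ck_on_bilinear:
  assumes "open S" "bounded_bilinear B" "Ck_on k S f" "Ck_on k S g"
  shows "Ck_on k S (\<lambda>x. B (f x) (g x))"
  using assms(3,4)
proof (induction k arbitrary: f g)
  case 0
  then show ?case using bounded_bilinear.continuous_on[OF assms(2)] by simp
next
  case (Suc k)
  show ?case
  proof (rule Ck_on_has_derivativeI[OF assms(1)])
    show "((\<lambda>x. B (f x) (g x)) has_derivative
        (\<lambda>v. B (f x) (frechet_derivative g (at x) v) + B (frechet_derivative f (at x) v) (g x))) (at x)"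
      if "x \<in> S" for x
      using Suc.prems that assms(1)
      by (intro bounded_bilinear.FDERIV[OF assms(2)] Ck_on_Suc_has_derivative) auto
    show "Ck_on k S (\<lambda>x. B (f x) (frechet_derivative g (at x) v) + B (frechet_derivative f (at x) v) (g x))" for v
      using Suc.prems Suc.prems[THEN Ck_on_Suc_imp_Ck_on]
      by (intro Ck_on_add[OF assms(1)] Suc.IH) simp_all
  qed
qed

lemma Ck_on_sum:
  assumes "open S" "\<And>i. i \<in> I \<Longrightarrow> Ck_on k S (f i)"
  shows "Ck_on k S (\<lambda>x. \<Sum>i\<in>I. f i x)"
  using assms(2)
  by (induction I rule: infinite_finite_induct) (auto intro: Ck_on_const Ck_on_add assms(1))

lemma linear_eq_sum_Basis:
  fixes f :: "'a::euclidean_space \<Rightarrow> 'b::real_normed_vector"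
  assumes "linear f"
  shows "f w = (\<Sum>b\<in>Basis. (w \<bullet> b) *\<^sub>R f b)"
proof -
  have "f (\<Sum>b\<in>Basis. (w \<bullet> b) *\<^sub>R b) = (\<Sum>b\<in>Basis. (w \<bullet> b) *\<^sub>R f b)"
    by (simp add: linear_sum[OF assms] linear_scale[OF assms])
  then show ?thesis by (simp add: euclidean_representation)
qed

text \<open>By the chain rule the derivative of \<open>f \<circ> g\<close> in direction v is
  \<open>\<Sum> ((Dg v) \<bullet> b) *\<^sub>R ((D\<^sub>b f) \<circ> g)\<close> over the basis vectors b, which is of class \<open>C\<^sup>k\<close> by the induction
  hypothesis for the partial derivatives of f. This is why the intermediate space is Euclidean.\<close>

lemma Ck_on_compose:
  fixes g :: "'a::real_normed_vector \<Rightarrow> 'b::euclidean_space" and f :: "'b \<Rightarrow> 'c::real_normed_vector"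
  assumes "open S" "open T" "g ` S \<subseteq> T" "Ck_on k S g" "Ck_on k T f"
  shows "Ck_on k S (\<lambda>x. f (g x))"
  using assms(4,5)
proof (induction k arbitrary: f)
  case 0
  then show ?case using assms(3) by (auto intro: continuous_on_compose2)
next
  case (Suc k)
  show ?case
  proof (rule Ck_on_has_derivativeI[OF assms(1)])
    fix x assume x: "x \<in> S"
    then have gx: "g x \<in> T" using assms(3) by auto
    have df: "(f has_derivative frechet_derivative f (at (g x))) (at (g x))"
      using Ck_on_Suc_has_derivative[OF assms(2) Suc.prems(2) gx] .
    show "((\<lambda>x. f (g x)) has_derivative
        (\<lambda>v. \<Sum>b\<in>Basis. (frechet_derivative g (at x) v \<bullet> b) *\<^sub>R frechet_derivative f (at (g x)) b)) (at x)"
      unfolding linear_eq_sum_Basis[OF has_derivative_linear[OF df], symmetric]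
      by (rule has_derivative_compose[OF Ck_on_Suc_has_derivative[OF assms(1) Suc.prems(1) x] df])
  next
    fix v
    show "Ck_on k S (\<lambda>x. \<Sum>b\<in>Basis. (frechet_derivative g (at x) v \<bullet> b) *\<^sub>R frechet_derivative f (at (g x)) b)"
      using Suc.prems Suc.prems(1)[THEN Ck_on_Suc_imp_Ck_on]
      by (intro Ck_on_sum Ck_on_bilinear[OF _ bounded_bilinear_scaleR] Suc.IH assms(1)
            Ck_on_linear_compose[OF _ bounded_linear_inner_left]) simp_all
  qed
qed

text \<open>The derivative \<open>v \<mapsto> - inverse x v inverse x\<close> is a polynomial in the function itself; the same idea works for
  the square root below.\<close>

lemma Ck_on_inverse: "Ck_on k (- {0}) (inverse :: 'a \<Rightarrow> 'a::real_normed_div_algebra)"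
proof (induction k)
  case 0
  show ?case by (auto intro: continuous_on_inverse)
next
  case (Suc k)
  show ?case
  proof (rule Ck_on_has_derivativeI)
    show "Ck_on k (- {0}) (\<lambda>x. - (inverse x * v * inverse x))" for v :: 'a
      by (intro Ck_on_linear_compose[OF _ bounded_linear_minus[OF bounded_linear_ident]]
            Ck_on_bilinear[OF _ bounded_bilinear_mult] Suc Ck_on_const) auto
  qed (auto intro: has_derivative_inverse')
qed

lemma Ck_on_sqrt: "Ck_on k {0<..} sqrt"
proof (induction k)
  case 0
  show ?case by (auto intro: continuous_intros)
next
  case (Suc k)
  have "Ck_on k {0<..} (\<lambda>x. inverse (sqrt x))"
    by (rule Ck_on_compose[OF _ _ _ Suc Ck_on_inverse]) auto
  then have *: "Ck_on k {0<..} (\<lambda>x. inverse (sqrt x) / 2 * v)" for v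
    by (intro Ck_on_bilinear[OF _ bounded_bilinear_mult] Ck_on_const
       Ck_on_linear_compose[OF _ bounded_linear_divide]) auto
  show ?case
  proof (rule Ck_on_has_derivativeI[OF _ _ *])
    show "(sqrt has_derivative (\<lambda>v. inverse (sqrt x) / 2 * v)) (at x)" if "x \<in> {0<..}" for x
      by (rule DERIV_real_sqrt[unfolded has_field_derivative_def]) (use that in simp)
  qed simp
qed

lemma smooth_on_cong: "open S \<Longrightarrow> (\<And>x. x \<in> S \<Longrightarrow> f x = g x) \<Longrightarrow> smooth_on S f \<Longrightarrow> smooth_on S g"
  unfolding smooth_on_def using Ck_on_cong by blast

lemma smooth_on_subset: "smooth_on S f \<Longrightarrow> T \<subseteq> S \<Longrightarrow> smooth_on T f"
  unfolding smooth_on_def using Ck_on_subset by blast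

lemma smooth_on_locally:
  assumes "\<And>x. x \<in> S \<Longrightarrow> \<exists>T. open T \<and> x \<in> T \<and> smooth_on T f"
  shows "smooth_on S f"
  unfolding smooth_on_def
proof (intro allI Ck_on_locally)
  fix k x assume "x \<in> S"
  from assms[OF this] show "\<exists>T. open T \<and> x \<in> T \<and> Ck_on k T f"
    unfolding smooth_on_def by blast
qed

lemma smooth_on_imp_continuous_on: "smooth_on S f \<Longrightarrow> continuous_on S f"
  unfolding smooth_on_def by (metis Ck_on.simps(1))

lemma smooth_on_has_derivative:
  "smooth_on S f \<Longrightarrow> open S \<Longrightarrow> x \<in> S \<Longrightarrow> (f has_derivative frechet_derivative f (at x)) (at x)"
  unfolding smooth_on_def using Ck_on_Suc_has_derivative by blast

lemma smooth_on_derivative: "smooth_on S f \<Longrightarrow> smooth_on S (\<lambda>x. frechet_derivative f (at x) v)"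
  unfolding smooth_on_def using Ck_on.simps(2) by blast

lemma smooth_on_const: "open S \<Longrightarrow> smooth_on S (\<lambda>x. c)"
  and smooth_on_ident: "open S \<Longrightarrow> smooth_on S (\<lambda>x. x)"
  and smooth_on_add: "open S \<Longrightarrow> smooth_on S f \<Longrightarrow> smooth_on S g \<Longrightarrow> smooth_on S (\<lambda>x. f x + g x)"
  by (simp_all add: smooth_on_def Ck_on_const Ck_on_ident Ck_on_add)

lemma smooth_on_linear_compose:
  "open S \<Longrightarrow> bounded_linear h \<Longrightarrow> smooth_on S f \<Longrightarrow> smooth_on S (\<lambda>x. h (f x))"
  by (simp add: smooth_on_def Ck_on_linear_compose)

lemma smooth_on_bilinear:
  "open S \<Longrightarrow> bounded_bilinear B \<Longrightarrow> smooth_on S f \<Longrightarrow> smooth_on S g \<Longrightarrow>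
    smooth_on S (\<lambda>x. B (f x) (g x))"
  by (simp add: smooth_on_def Ck_on_bilinear)

lemma smooth_on_compose:
  fixes g :: "'a::real_normed_vector \<Rightarrow> 'b::euclidean_space"
  shows "open S \<Longrightarrow> open T \<Longrightarrow> g ` S \<subseteq> T \<Longrightarrow> smooth_on S g \<Longrightarrow> smooth_on T f \<Longrightarrow>
    smooth_on S (\<lambda>x. f (g x))"
  unfolding smooth_on_def using Ck_on_compose by blast

lemma smooth_on_sum: "open S \<Longrightarrow> (\<And>i. i \<in> I \<Longrightarrow> smooth_on S (f i)) \<Longrightarrow> smooth_on S (\<lambda>x. \<Sum>i\<in>I. f i x)"
  by (simp add: smooth_on_def Ck_on_sum)

lemma smooth_on_inverse:
  fixes f :: "_ \<Rightarrow> 'a::{real_normed_div_algebra,euclidean_space}"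
  shows "open S \<Longrightarrow> smooth_on S f \<Longrightarrow> (\<And>x. x \<in> S \<Longrightarrow> f x \<noteq> 0) \<Longrightarrow> smooth_on S (\<lambda>x. inverse (f x))"
  by (rule smooth_on_compose[where T = "- {0}"]) (auto simp: smooth_on_def Ck_on_inverse)

lemma smooth_on_sqrt:
  "open S \<Longrightarrow> smooth_on S f \<Longrightarrow> (\<And>x. x \<in> S \<Longrightarrow> f x > 0) \<Longrightarrow> smooth_on S (\<lambda>x. sqrt (f x))"
  by (rule smooth_on_compose[where T = "{0<..}"]) (auto simp: smooth_on_def Ck_on_sqrt)

lemma smooth_on_linear: "open S \<Longrightarrow> bounded_linear h \<Longrightarrow> smooth_on S h"
  using smooth_on_linear_compose smooth_on_ident by blast

lemma smooth_on_mult: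
  fixes f :: "_ \<Rightarrow> 'a::real_normed_algebra"
  shows "open S \<Longrightarrow> smooth_on S f \<Longrightarrow> smooth_on S g \<Longrightarrow> smooth_on S (\<lambda>x. f x * g x)"
  by (rule smooth_on_bilinear[OF _ bounded_bilinear_mult])

lemma smooth_on_scaleR:
  "open S \<Longrightarrow> smooth_on S f \<Longrightarrow> smooth_on S g \<Longrightarrow> smooth_on S (\<lambda>x. f x *\<^sub>R g x)"
  by (rule smooth_on_bilinear[OF _ bounded_bilinear_scaleR])

lemma smooth_on_inner:
  "open S \<Longrightarrow> smooth_on S f \<Longrightarrow> smooth_on S g \<Longrightarrow> smooth_on S (\<lambda>x. f x \<bullet> g x)"
  by (rule smooth_on_bilinear[OF _ bounded_bilinear_inner])

lemma smooth_on_minus: "open S \<Longrightarrow> smooth_on S f \<Longrightarrow> smooth_on S (\<lambda>x. - f x)"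
  by (rule smooth_on_linear_compose[OF _ bounded_linear_minus[OF bounded_linear_ident]])

lemma smooth_on_diff:
  "open S \<Longrightarrow> smooth_on S f \<Longrightarrow> smooth_on S g \<Longrightarrow> smooth_on S (\<lambda>x. f x - g x)"
  using smooth_on_add[of S f "\<lambda>x. - g x"] smooth_on_minus by auto

lemma smooth_on_divide:
  fixes f :: "_ \<Rightarrow> 'a::{real_normed_field,euclidean_space}"
  shows "open S \<Longrightarrow> smooth_on S f \<Longrightarrow> smooth_on S g \<Longrightarrow> (\<And>x. x \<in> S \<Longrightarrow> g x \<noteq> 0) \<Longrightarrow>
    smooth_on S (\<lambda>x. f x / g x)"
  unfolding divide_inverse by (intro smooth_on_mult smooth_on_inverse)

lemma smooth_on_Pair:
  assumes "open S" "smooth_on S f" "smooth_on S g"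
  shows "smooth_on S (\<lambda>x. (f x, g x))"
proof -
  have "smooth_on S (\<lambda>x. (f x, 0) + (0, g x))"
    using assms by (intro smooth_on_add smooth_on_linear_compose[of S "\<lambda>y. (y, 0)"]
      smooth_on_linear_compose[of S "\<lambda>y. (0, y)"] bounded_linear_Pair bounded_linear_ident bounded_linear_zero)
  then show ?thesis by simp
qed

lemma smooth_on_vec:
  fixes f :: "'m::finite \<Rightarrow> _ \<Rightarrow> 'a::euclidean_space"
  assumes "open S" "\<And>i. smooth_on S (f i)"
  shows "smooth_on S (\<lambda>x. \<chi> i. f i x)"
proof -
  have "bounded_linear (axis i :: 'a \<Rightarrow> 'a ^ 'm)" for i :: 'm
    by (intro linear_conv_bounded_linear[THEN iffD1] linearI) (auto simp: axis_def vec_eq_iff)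
  then have "smooth_on S (\<lambda>x. \<Sum>i\<in>UNIV. axis i (f i x))"
    using assms by (intro smooth_on_sum smooth_on_linear_compose[of S "axis _"]) auto
  moreover have "(\<Sum>i\<in>UNIV. axis i (f i x)) = (\<chi> i. f i x)" for x
    by (simp add: vec_eq_iff axis_def if_distrib cong: if_cong)
  ultimately show ?thesis by simp
qed

lemma smooth_on_vec_nth: "open S \<Longrightarrow> smooth_on S f \<Longrightarrow> smooth_on S (\<lambda>x. f x $ i)"
  by (rule smooth_on_linear_compose[OF _ bounded_linear_vec_nth])

lemma smooth_on_fst: "open S \<Longrightarrow> smooth_on S f \<Longrightarrow> smooth_on S (\<lambda>x. fst (f x))"
  and smooth_on_snd: "open S \<Longrightarrow> smooth_on S f \<Longrightarrow> smooth_on S (\<lambda>x. snd (f x))"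
  by (auto intro: smooth_on_linear_compose bounded_linear_fst bounded_linear_snd)

text \<open>Smoothness of the derivative in the base point and the direction jointly, as needed for the charts of
  tangent bundles.\<close>

lemma smooth_on_tangent_map:
  fixes f :: "'a::euclidean_space \<Rightarrow> 'b::real_normed_vector"
  assumes "open S" "smooth_on S f"
  shows "smooth_on (S \<times> UNIV) (\<lambda>p. frechet_derivative f (at (fst p)) (snd p))"
proof -
  have o: "open (S \<times> (UNIV :: 'a set))" by (simp add: assms(1) open_Times)
  have "smooth_on (S \<times> UNIV) (\<lambda>p :: 'a \<times> 'a. frechet_derivative f (at (fst p)) b)" for b
    by (rule smooth_on_compose[of "S \<times> UNIV" S fst, OF o assms(1) _ _ smooth_on_derivative[OF assms(2)]])
       (auto intro: smooth_on_linear[OF o bounded_linear_fst])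
  then have sm: "smooth_on (S \<times> UNIV) (\<lambda>p. \<Sum>b\<in>Basis. (snd p \<bullet> b) *\<^sub>R frechet_derivative f (at (fst p)) b)"
    by (intro smooth_on_sum smooth_on_scaleR smooth_on_inner smooth_on_snd smooth_on_ident smooth_on_const o)
  have eq: "(\<Sum>b\<in>Basis. (snd p \<bullet> b) *\<^sub>R frechet_derivative f (at (fst p)) b)
      = frechet_derivative f (at (fst p)) (snd p)" if "p \<in> S \<times> UNIV" for p
  proof -
    have "linear (frechet_derivative f (at (fst p)))"
      using that by (intro has_derivative_linear[OF smooth_on_has_derivative[OF assms(2,1)]]) auto
    from linear_eq_sum_Basis[OF this] show ?thesis by (rule sym)
  qed
  show ?thesis by (rule smooth_on_cong[OF o eq sm])
qed

section \<open>Manifolds covered by a submersion with sections\<close>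

text \<open>A manifold M presented as the image of an open set E under a map \<open>pr\<close>. The maps \<open>lch i\<close> are the charts
  of M lifted to E, and \<open>sec i\<close> is a smooth section of \<open>pr\<close> over the chart domain, in coordinates. The map
  \<open>pr\<close> behaves like a submersion, so M inherits its smooth structure from E.\<close>

locale smooth_cover =
  fixes M :: "('p, 'i, 'e::euclidean_space) mfd"
    and E :: "'l::euclidean_space set"
    and pr :: "'l \<Rightarrow> 'p"
    and lch :: "'i \<Rightarrow> 'l \<Rightarrow> 'e"
    and sec :: "'i \<Rightarrow> 'e \<Rightarrow> 'l"
  assumes open_total: "open E"
    and pr_image: "pr ` E = points M"
    and open_over: "open {z \<in> E. pr z \<in> chart_dom M i}"
    and smooth_lch: "smooth_on {z \<in> E. pr z \<in> chart_dom M i} (lch i)"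
    and chart_pr: "z \<in> E \<Longrightarrow> pr z \<in> chart_dom M i \<Longrightarrow> chart M i (pr z) = lch i z"
    and open_chart_image: "open (chart M i ` chart_dom M i)"
    and smooth_sec: "smooth_on (chart M i ` chart_dom M i) (sec i)"
    and sec_in: "p \<in> chart_dom M i \<Longrightarrow> sec i (chart M i p) \<in> E"
    and pr_sec: "p \<in> chart_dom M i \<Longrightarrow> pr (sec i (chart M i p)) = p"

text \<open>The differential of \<open>pr\<close>: the tangent vector of M at \<open>pr z\<close> represented by u.\<close>

definition push ::
  "('p, 'i, 'e::euclidean_space) mfd \<Rightarrow> ('l::euclidean_space \<Rightarrow> 'p) \<Rightarrow> ('i \<Rightarrow> 'l \<Rightarrow> 'e) \<Rightarrow>
   'l \<Rightarrow> 'l \<Rightarrow> ('i \<Rightarrow> 'e)" where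
  "push M pr lch z u = (\<lambda>i. if pr z \<in> chart_dom M i then frechet_derivative (lch i) (at z) u else 0)"

context smooth_cover
begin

lemma chart_inv_eq:
  assumes "a \<in> chart M i ` chart_dom M i"
  shows "chart_inv M i a = pr (sec i a)"
proof -
  obtain p where p: "p \<in> chart_dom M i" "a = chart M i p" using assms by auto
  have "inj_on (chart M i) (chart_dom M i)" by (metis inj_onI pr_sec)
  then show ?thesis unfolding chart_inv_def p(2) using p(1) pr_sec by simp
qed

lemma sec_over:
  assumes "a \<in> chart M i ` chart_dom M i"
  shows "sec i a \<in> E" "pr (sec i a) \<in> chart_dom M i" "lch i (sec i a) = a"
proof -
  obtain p where p: "p \<in> chart_dom M i" "a = chart M i p" using assms by auto
  show 1: "sec i a \<in> E" and 2: "pr (sec i a) \<in> chart_dom M i"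
    using sec_in[OF p(1)] pr_sec[OF p(1)] p by auto
  show "lch i (sec i a) = a"
    using chart_pr[OF 1 2] pr_sec[OF p(1)] p by simp
qed

lemma in_points: "z \<in> E \<Longrightarrow> pr z \<in> points M"
  using pr_image by blast

lemma lch_has_derivative:
  assumes "z \<in> E" "pr z \<in> chart_dom M i"
  shows "(lch i has_derivative frechet_derivative (lch i) (at z)) (at z)"
  using smooth_on_has_derivative[OF smooth_lch open_over] assms by simp

lemma sec_has_derivative:
  assumes "a \<in> chart M i ` chart_dom M i"
  shows "(sec i has_derivative frechet_derivative (sec i) (at a)) (at a)"
  using smooth_on_has_derivative[OF smooth_sec open_chart_image] assms by simp

end

text \<open>In coordinates, f is the composite of a section, the local lift h and a lifted chart.\<close>

lemma smooth_mapI: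
  assumes "smooth_cover M E pr lch sec" "smooth_cover N E' pr' lch' sec'"
    and lift: "\<And>z. z \<in> E \<Longrightarrow> \<exists>W h. open W \<and> z \<in> W \<and> W \<subseteq> E \<and> smooth_on W h \<and> h ` W \<subseteq> E' \<and>
      (\<forall>y\<in>W. f (pr y) = pr' (h y))"
  shows "smooth_map M N f"
proof -
  interpret M: smooth_cover M E pr lch sec by fact
  interpret N: smooth_cover N E' pr' lch' sec' by fact
  have "\<exists>T. open T \<and> a \<in> T \<and> T \<subseteq> chart M i ` {p \<in> chart_dom M i. f p \<in> chart_dom N j} \<and>
      smooth_on T (chart N j \<circ> f \<circ> chart_inv M i)"
    if a: "a \<in> chart M i ` {p \<in> chart_dom M i. f p \<in> chart_dom N j}" for a i j
  proof -
    let ?V = "chart M i ` chart_dom M i"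
    have aV: "a \<in> ?V" using a by auto
    obtain W h where W: "open W" "sec i a \<in> W" "W \<subseteq> E" "smooth_on W h" "h ` W \<subseteq> E'"
        "\<And>y. y \<in> W \<Longrightarrow> f (pr y) = pr' (h y)"
      using lift[OF M.sec_over(1)[OF aV]] by blast
    define W' where "W' = W \<inter> h -` {z \<in> E'. pr' z \<in> chart_dom N j}"
    define T where "T = ?V \<inter> sec i -` W'"
    have oW': "open W'" unfolding W'_def
      by (rule continuous_open_preimage[OF smooth_on_imp_continuous_on[OF W(4)] W(1) N.open_over])
    have oT: "open T" unfolding T_def
      by (rule continuous_open_preimage[OF smooth_on_imp_continuous_on[OF M.smooth_sec] M.open_chart_image oW'])
    have "f (pr (sec i a)) \<in> chart_dom N j" using a M.pr_sec by auto
    then have aT: "a \<in> T" unfolding T_def W'_def using W aV by auto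
    have TU: "T \<subseteq> chart M i ` {p \<in> chart_dom M i. f p \<in> chart_dom N j}"
    proof
      fix b assume b: "b \<in> T"
      then have bV: "b \<in> ?V" and bW: "sec i b \<in> W'" by (auto simp: T_def)
      have "b = chart M i (pr (sec i b))"
        using M.chart_pr M.sec_over[OF bV] by simp
      moreover have "f (pr (sec i b)) \<in> chart_dom N j" using bW W(6) by (auto simp: W'_def)
      ultimately show "b \<in> chart M i ` {p \<in> chart_dom M i. f p \<in> chart_dom N j}"
        using M.sec_over[OF bV] by blast
    qed
    have sm: "smooth_on T (\<lambda>b. lch' j (h (sec i b)))"
    proof (rule smooth_on_compose[of T W' "sec i" "\<lambda>y. lch' j (h y)", OF oT oW'])
      show "sec i ` T \<subseteq> W'" by (auto simp: T_def)
      show "smooth_on T (sec i)" using M.smooth_sec by (rule smooth_on_subset) (auto simp: T_def)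
      show "smooth_on W' (\<lambda>y. lch' j (h y))"
        by (rule smooth_on_compose[OF oW' N.open_over _ _ N.smooth_lch])
          (use W(4) in \<open>auto simp: W'_def intro: smooth_on_subset\<close>)
    qed
    have eq: "lch' j (h (sec i b)) = (chart N j \<circ> f \<circ> chart_inv M i) b" if "b \<in> T" for b
    proof -
      have bV: "b \<in> ?V" and bW: "sec i b \<in> W'" using that by (auto simp: T_def)
      then show ?thesis using W(6)[of "sec i b"]
        by (simp add: M.chart_inv_eq[OF bV] W'_def N.chart_pr)
    qed
    have "smooth_on T (chart N j \<circ> f \<circ> chart_inv M i)"
      by (rule smooth_on_cong[OF oT eq sm])
    then show ?thesis using oT aT TU by (intro exI[of _ T]) simp
  qed
  note loc = this
  have "open (chart M i ` {p \<in> chart_dom M i. f p \<in> chart_dom N j})" for i j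
    by (subst open_subopen) (use loc[of _ i j] in blast)
  moreover have "smooth_on (chart M i ` {p \<in> chart_dom M i. f p \<in> chart_dom N j})
      (chart N j \<circ> f \<circ> chart_inv M i)" for i j
    by (rule smooth_on_locally) (use loc[of _ i j] in blast)
  moreover have "f ` points M \<subseteq> points N"
  proof
    fix q assume "q \<in> f ` points M"
    then obtain z where z: "z \<in> E" "q = f (pr z)" using M.pr_image by (metis imageE)
    obtain W h where "z \<in> W" "h ` W \<subseteq> E'" "\<And>y. y \<in> W \<Longrightarrow> f (pr y) = pr' (h y)"
      using lift[OF z(1)] by blast
    then show "q \<in> points N" using z N.in_points by auto
  qed
  ultimately show ?thesis by (simp add: smooth_map_def Let_def)
qed

lemma smooth_map_globalI:
  assumes "smooth_cover M E pr lch sec" "smooth_cover N E' pr' lch' sec'"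
    and "smooth_on E h" "\<And>z. z \<in> E \<Longrightarrow> h z \<in> E'" "\<And>z. z \<in> E \<Longrightarrow> f (pr z) = pr' (h z)"
  shows "smooth_map M N f"
proof (rule smooth_mapI[OF assms(1,2)])
  fix z assume "z \<in> E"
  then show "\<exists>W h. open W \<and> z \<in> W \<and> W \<subseteq> E \<and> smooth_on W h \<and> h ` W \<subseteq> E' \<and> (\<forall>y\<in>W. f (pr y) = pr' (h y))"
    using assms(3-5) smooth_cover.open_total[OF assms(1)] by (intro exI[of _ E] exI[of _ h]) auto
qed

text \<open>The lift h sends the section through \<open>pr z\<close> to a point over \<open>f (pr z)\<close> that may differ from \<open>h z\<close>,
  so the local representative g of f is not differentiated as a composite. Instead, \<open>g \<circ> lch i = lch' j \<circ> h\<close>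
  holds near z, and both sides are differentiated; g is differentiable because f is smooth.\<close>

lemma frechet_derivative_local_rep:
  assumes "smooth_cover M E pr lch sec" "smooth_cover N E' pr' lch' sec'"
    and f: "smooth_map M N f"
    and W: "open W" "z \<in> W" "W \<subseteq> E" "\<And>y. y \<in> W \<Longrightarrow> h y \<in> E' \<and> f (pr y) = pr' (h y)"
    and D: "(h has_derivative D) (at z)"
    and i: "pr z \<in> chart_dom M i" and j: "f (pr z) \<in> chart_dom N j"
  shows "frechet_derivative (chart N j \<circ> f \<circ> chart_inv M i) (at (chart M i (pr z)))
           (frechet_derivative (lch i) (at z) u) = frechet_derivative (lch' j) (at (h z)) (D u)"
proof -
  interpret M: smooth_cover M E pr lch sec by fact
  interpret N: smooth_cover N E' pr' lch' sec' by fact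
  let ?g = "chart N j \<circ> f \<circ> chart_inv M i"
  let ?U = "chart M i ` {p \<in> chart_dom M i. f p \<in> chart_dom N j}"
  have z: "z \<in> E" using W by auto
  have c: "chart M i (pr z) = lch i z" using M.chart_pr[OF z i] .
  have "open ?U" "smooth_on ?U ?g" using f by (auto simp: smooth_map_def Let_def)
  then have "(?g has_derivative frechet_derivative ?g (at (chart M i (pr z)))) (at (chart M i (pr z)))"
    using smooth_on_has_derivative i j by blast
  then have 1: "((\<lambda>y. ?g (lch i y)) has_derivative
      (\<lambda>u. frechet_derivative ?g (at (chart M i (pr z))) (frechet_derivative (lch i) (at z) u))) (at z)"
    using has_derivative_compose[OF M.lch_has_derivative[OF z i], of ?g] c by simp
  have hz: "h z \<in> E'" "pr' (h z) \<in> chart_dom N j" using W j by auto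
  have 2: "((\<lambda>y. lch' j (h y)) has_derivative (\<lambda>u. frechet_derivative (lch' j) (at (h z)) (D u))) (at z)"
    by (rule has_derivative_compose[OF D N.lch_has_derivative[OF hz]])
  let ?X = "W \<inter> {y \<in> E. pr y \<in> chart_dom M i}"
  have "((\<lambda>y. ?g (lch i y)) has_derivative (\<lambda>u. frechet_derivative (lch' j) (at (h z)) (D u))) (at z)"
  proof -
    have "continuous (at z) h" using D by (rule has_derivative_continuous)
    then obtain Y where Y: "open Y" "z \<in> Y" "\<And>y. y \<in> Y \<Longrightarrow> h y \<in> {w \<in> E'. pr' w \<in> chart_dom N j}"
      using N.open_over[of j] hz unfolding continuous_at_open
      by (metis (mono_tags, lifting) mem_Collect_eq)
    show ?thesis
    proof (rule has_derivative_transform_within_open[OF 2, of "?X \<inter> Y"])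
      show "open (?X \<inter> Y)" using W(1) M.open_over[of i] Y(1) by auto
      show "z \<in> ?X \<inter> Y" using W(2) z i Y(2) by auto
      fix y assume y: "y \<in> ?X \<inter> Y"
      have "chart_inv M i (chart M i (pr y)) = pr y"
        using y M.chart_inv_eq M.pr_sec by auto
      moreover have "chart M i (pr y) = lch i y" using y M.chart_pr by auto
      moreover have "chart N j (pr' (h y)) = lch' j (h y)" using y Y(3)[of y] N.chart_pr by auto
      moreover have "f (pr y) = pr' (h y)" using y W(4) by auto
      ultimately show "lch' j (h y) = ?g (lch i y)" by simp
    qed
  qed
  from has_derivative_unique[OF 1 this] show ?thesis by metis
qed

lemma chart_at_in: "p \<in> points M \<Longrightarrow> p \<in> chart_dom M (chart_at M p)"
  unfolding points_def chart_at_def by (auto intro: someI)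

lemma differential_push:
  assumes "smooth_cover M E pr lch sec" "smooth_cover N E' pr' lch' sec'"
    and f: "smooth_map M N f"
    and W: "open W" "z \<in> W" "W \<subseteq> E" "\<And>y. y \<in> W \<Longrightarrow> h y \<in> E' \<and> f (pr y) = pr' (h y)"
    and D: "(h has_derivative D) (at z)"
  shows "differential M N f (pr z) (push M pr lch z u) = push N pr' lch' (h z) (D u)"
proof
  fix j
  have "pr z \<in> points M" using assms(1) W smooth_cover.in_points by blast
  note i = chart_at_in[OF this]
  have hz: "f (pr z) = pr' (h z)" using W by auto
  show "differential M N f (pr z) (push M pr lch z u) j = push N pr' lch' (h z) (D u) j"
  proof (cases "f (pr z) \<in> chart_dom N j")
    case True
    show ?thesis
      using frechet_derivative_local_rep[OF assms(1-3) W D i True, of u] True i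
      by (simp add: differential_def push_def Let_def hz)
  next
    case False
    then show ?thesis by (simp add: differential_def push_def Let_def hz)
  qed
qed

lemma differential_push_global:
  assumes "smooth_cover M E pr lch sec" "smooth_cover N E' pr' lch' sec'"
    and "smooth_on E h" "\<And>z. z \<in> E \<Longrightarrow> h z \<in> E'" "\<And>z. z \<in> E \<Longrightarrow> f (pr z) = pr' (h z)"
    and "z \<in> E" "(h has_derivative D) (at z)"
  shows "differential M N f (pr z) (push M pr lch z u) = push N pr' lch' (h z) (D u)"
  by (rule differential_push[OF assms(1,2) smooth_map_globalI[OF assms(1-5)]
        smooth_cover.open_total[OF assms(1)] assms(6) order_refl _ assms(7)])
     (use assms in auto)

context smooth_cover
begin

lemma push_tangent:
  assumes "z \<in> E"
  shows "push M pr lch z u \<in> tangent_space M (pr z)"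
proof -
  have c: "smooth_cover M E pr lch sec" by unfold_locales
  have id: "smooth_map M M (\<lambda>p. p)"
    by (rule smooth_map_globalI[OF c c, of "\<lambda>z. z"]) (auto simp: smooth_on_ident open_total)
  have "frechet_derivative (chart M j \<circ> chart_inv M i) (at (chart M i (pr z)))
      (frechet_derivative (lch i) (at z) u) = frechet_derivative (lch j) (at z) u"
    if "pr z \<in> chart_dom M i" "pr z \<in> chart_dom M j" for i j
    using frechet_derivative_local_rep[OF c c id open_total assms order_refl _ has_derivative_ident that, of u]
    by (simp add: comp_def)
  then show ?thesis by (auto simp: tangent_space_def push_def)
qed

text \<open>Every tangent vector at p has a representative at the point of E that the section chooses over p,
  namely the derivative of the section applied to its i-th component.\<close>

lemma tangent_eq_push:
  assumes v: "v \<in> tangent_space M p" and p: "p \<in> chart_dom M i"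
  shows "v = push M pr lch (sec i (chart M i p)) (frechet_derivative (sec i) (at (chart M i p)) (v i))"
    (is "v = push M pr lch ?z (?D (v i))")
proof
  fix j
  let ?a = "chart M i p"
  have a: "?a \<in> chart M i ` chart_dom M i" using p by auto
  have z: "?z \<in> E" and prz: "pr ?z = p" using p sec_in pr_sec by auto
  show "v j = push M pr lch ?z (?D (v i)) j"
  proof (cases "p \<in> chart_dom M j")
    case True
    let ?T = "chart M i ` chart_dom M i \<inter> sec i -` {z \<in> E. pr z \<in> chart_dom M j}"
    have "((\<lambda>b. lch j (sec i b)) has_derivative (\<lambda>b. frechet_derivative (lch j) (at ?z) (?D b))) (at ?a)"
      using has_derivative_compose[OF sec_has_derivative[OF a] lch_has_derivative[OF z, of j]] True prz by simp
    then have "((chart M j \<circ> chart_inv M i) has_derivative (\<lambda>b. frechet_derivative (lch j) (at ?z) (?D b))) (at ?a)"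
    proof (rule has_derivative_transform_within_open[of _ _ _ _ ?T])
      show "open ?T"
        by (rule continuous_open_preimage[OF smooth_on_imp_continuous_on[OF smooth_sec] open_chart_image open_over])
      show "?a \<in> ?T" using a z prz True by auto
      show "lch j (sec i b) = (chart M j \<circ> chart_inv M i) b" if "b \<in> ?T" for b
        using that chart_inv_eq[of b i] chart_pr[of "sec i b" j] by auto
    qed
    from frechet_derivative_at[OF this, symmetric]
    have "frechet_derivative (chart M j \<circ> chart_inv M i) (at ?a) (v i)
        = frechet_derivative (lch j) (at ?z) (?D (v i))"
      by (rule fun_cong)
    moreover have "v j = frechet_derivative (chart M j \<circ> chart_inv M i) (at ?a) (v i)"
      using v p True unfolding tangent_space_def by blast
    ultimately show ?thesis using True by (simp add: push_def prz)
  next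
    case False
    then show ?thesis using v by (simp add: tangent_space_def push_def prz)
  qed
qed

lemma lch_sec_derivative:
  assumes a: "a \<in> chart M i ` chart_dom M i"
  shows "frechet_derivative (lch i) (at (sec i a)) (frechet_derivative (sec i) (at a) b) = b"
proof -
  have "((\<lambda>b. lch i (sec i b)) has_derivative
      (\<lambda>b. frechet_derivative (lch i) (at (sec i a)) (frechet_derivative (sec i) (at a) b))) (at a)"
    using has_derivative_compose[OF sec_has_derivative[OF a] lch_has_derivative[OF sec_over(1,2)[OF a]]] .
  then have "((\<lambda>b. b) has_derivative
      (\<lambda>b. frechet_derivative (lch i) (at (sec i a)) (frechet_derivative (sec i) (at a) b))) (at a)"
    by (rule has_derivative_transform_within_open[OF _ open_chart_image a]) (simp add: sec_over)
  from has_derivative_unique[OF this has_derivative_ident] show ?thesis by metis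
qed

text \<open>The constant coordinate fields in the definition of the exterior derivative lift to the derivative of
  the section.\<close>

lemma tangent_of_eq:
  assumes a: "a \<in> chart M i ` chart_dom M i"
  shows "tangent_of M i (pr (sec i a)) b = push M pr lch (sec i a) (frechet_derivative (sec i) (at a) b)"
  unfolding tangent_of_def
proof (rule the_equality)
  let ?v = "push M pr lch (sec i a) (frechet_derivative (sec i) (at a) b)"
  show "?v \<in> tangent_space M (pr (sec i a)) \<and> ?v i = b"
    using push_tangent[OF sec_over(1)[OF a]] lch_sec_derivative[OF a] sec_over(2)[OF a]
    by (simp add: push_def)
  fix v assume v: "v \<in> tangent_space M (pr (sec i a)) \<and> v i = b"
  then have "v \<in> tangent_space M (pr (sec i a))" by simp
  from tangent_eq_push[OF this sec_over(2)[OF a]] v chart_pr[OF sec_over(1,2)[OF a]] sec_over(3)[OF a]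
  show "v = ?v" by simp
qed

text \<open>If the section is affine, constant coordinate fields lift to constant fields L b, and the coordinate
  formula for the exterior derivative becomes the same formula upstairs.\<close>

lemma ext_deriv_affine_section:
  assumes p: "p \<in> chart_dom M i" "i = chart_at M p"
    and L: "\<And>a. a \<in> chart M i ` chart_dom M i \<Longrightarrow> frechet_derivative (sec i) (at a) = L"
    and D: "\<And>b. ((\<lambda>z. \<theta> (pr z) (push M pr lch z (L b))) has_derivative D (L b)) (at (sec i (chart M i p)))"
  shows "ext_deriv M \<theta> p v w = D (L (w i)) (L (v i)) - D (L (v i)) (L (w i))"
proof -
  let ?V = "chart M i ` chart_dom M i"
  let ?a = "chart M i p"
  have a: "?a \<in> ?V" using p by auto
  have "frechet_derivative (\<lambda>x. \<theta> (chart_inv M i x) (tangent_of M i (chart_inv M i x) b)) (at ?a)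
      = (\<lambda>c. D (L b) (L c))" for b
  proof -
    have "((\<lambda>x. \<theta> (pr (sec i x)) (push M pr lch (sec i x) (L b))) has_derivative (\<lambda>c. D (L b) (L c))) (at ?a)"
      using has_derivative_compose[OF sec_has_derivative[OF a] D[of b]] L[OF a] by simp
    then have "((\<lambda>x. \<theta> (chart_inv M i x) (tangent_of M i (chart_inv M i x) b)) has_derivative
        (\<lambda>c. D (L b) (L c))) (at ?a)"
      by (rule has_derivative_transform_within_open[OF _ open_chart_image a])
        (simp add: chart_inv_eq tangent_of_eq L)
    then show ?thesis by (rule frechet_derivative_at[symmetric])
  qed
  then show ?thesis unfolding ext_deriv_def Let_def p(2)[symmetric] by simp
qed

lemma restrict_cover:
  assumes o: "open {z \<in> E. pr z \<in> S}"
  shows "smooth_cover (restrict_mfd M S) {z \<in> E. pr z \<in> S} pr lch sec"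
proof
  show "open {z \<in> E. pr z \<in> S}" by fact
  show "pr ` {z \<in> E. pr z \<in> S} = points (restrict_mfd M S)"
    using pr_image by (auto simp: points_def restrict_mfd_def)
  fix i
  let ?O = "{z \<in> {z \<in> E. pr z \<in> S}. pr z \<in> chart_dom (restrict_mfd M S) i}"
  have O: "?O = {z \<in> E. pr z \<in> S} \<inter> {z \<in> E. pr z \<in> chart_dom M i}"
    by (auto simp: restrict_mfd_def)
  show "open ?O" unfolding O using o open_over by blast
  show "smooth_on ?O (lch i)"
    using smooth_lch by (rule smooth_on_subset) (auto simp: restrict_mfd_def)
  let ?V = "chart (restrict_mfd M S) i ` chart_dom (restrict_mfd M S) i"
  have V: "?V = chart M i ` chart_dom M i \<inter> sec i -` {z \<in> E. pr z \<in> S}"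
    using sec_in pr_sec by (auto simp: restrict_mfd_def)
  show "open ?V" unfolding V
    by (rule continuous_open_preimage[OF smooth_on_imp_continuous_on[OF smooth_sec] open_chart_image o])
  show "smooth_on ?V (sec i)"
    using smooth_sec by (rule smooth_on_subset) (auto simp: restrict_mfd_def)
qed (use chart_pr sec_in pr_sec in \<open>auto simp: restrict_mfd_def\<close>)

lemma push_restrict: "pr z \<in> S \<Longrightarrow> push (restrict_mfd M S) pr lch z u = push M pr lch z u"
  by (simp add: push_def restrict_mfd_def)

text \<open>A tangent vector is given by a pair of a point of E and a representative there, so the tangent bundle of
  M is covered by \<open>E \<times> UNIV\<close>; the lifted charts and the sections are the tangent maps of those for M.\<close>

lemma tangent_bundle_cover:
  "smooth_cover (tangent_bundle M) (E \<times> UNIV)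
     (\<lambda>y. (pr (fst y), push M pr lch (fst y) (snd y)))
     (\<lambda>i y. (lch i (fst y), frechet_derivative (lch i) (at (fst y)) (snd y)))
     (\<lambda>i y. (sec i (fst y), frechet_derivative (sec i) (at (fst y)) (snd y)))"
  (is "smooth_cover ?T _ ?pr ?lch ?sec")
proof
  show "open (E \<times> (UNIV :: 'l set))" by (simp add: open_total open_Times)
  have dom: "chart_dom ?T i = {(p, v). p \<in> chart_dom M i \<and> v \<in> tangent_space M p}" for i
    by (simp add: tangent_bundle_def)
  have ch: "chart ?T i = (\<lambda>(p, v). (chart M i p, v i))" for i
    by (simp add: tangent_bundle_def)
  show "?pr ` (E \<times> UNIV) = points ?T"
  proof
    show "?pr ` (E \<times> UNIV) \<subseteq> points ?T"
      using in_points push_tangent by (fastforce simp: points_def dom)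
    show "points ?T \<subseteq> ?pr ` (E \<times> UNIV)"
    proof
      fix y assume "y \<in> points ?T"
      then obtain i p v where y: "y = (p, v)" "p \<in> chart_dom M i" "v \<in> tangent_space M p"
        by (auto simp: points_def dom)
      then have "y = ?pr (sec i (chart M i p), frechet_derivative (sec i) (at (chart M i p)) (v i))"
        using tangent_eq_push[OF y(3,2)] pr_sec by simp
      then show "y \<in> ?pr ` (E \<times> UNIV)"
        using sec_in[OF y(2)] by blast
    qed
  qed
  fix i
  let ?O = "{z \<in> E \<times> UNIV. ?pr z \<in> chart_dom ?T i}"
  have O: "?O = {z \<in> E. pr z \<in> chart_dom M i} \<times> UNIV"
    using push_tangent by (auto simp: dom)
  show oO: "open ?O" unfolding O using open_over by (simp add: open_Times)
  have "smooth_on ?O (\<lambda>y. lch i (fst y))" unfolding O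
    by (rule smooth_on_compose[OF oO[unfolded O] open_over _ _ smooth_lch])
       (auto intro: smooth_on_linear[OF oO[unfolded O] bounded_linear_fst])
  moreover have "smooth_on ?O (\<lambda>y. frechet_derivative (lch i) (at (fst y)) (snd y))" unfolding O
    by (rule smooth_on_tangent_map[OF open_over smooth_lch])
  ultimately show "smooth_on ?O (?lch i)" using oO by (intro smooth_on_Pair)
  show "chart ?T i (?pr z) = ?lch i z" if "z \<in> E \<times> UNIV" "?pr z \<in> chart_dom ?T i" for z
    using that by (auto simp: dom ch chart_pr push_def)
  let ?TV = "chart ?T i ` chart_dom ?T i :: ('e \<times> 'e) set"
  let ?MV = "chart M i ` chart_dom M i"
  have V: "?TV = ?MV \<times> UNIV"
  proof
    show "?TV \<subseteq> ?MV \<times> UNIV" by (auto simp: dom ch)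
    show "?MV \<times> UNIV \<subseteq> ?TV"
    proof
      fix ab assume "ab \<in> ?MV \<times> (UNIV :: 'e set)"
      then obtain a b where ab: "ab = (a, b)" "a \<in> ?MV" by auto
      note s = sec_over[OF ab(2)]
      let ?y = "?pr (sec i a, frechet_derivative (sec i) (at a) b)"
      have "?y \<in> chart_dom ?T i" using s push_tangent by (auto simp: dom)
      moreover have "chart ?T i ?y = ab"
        using s chart_pr lch_sec_derivative[OF ab(2)] ab(1) by (simp add: ch push_def)
      ultimately show "ab \<in> ?TV" by (metis image_eqI)
    qed
  qed
  show oV: "open ?TV" unfolding V using open_chart_image by (simp add: open_Times)
  have "smooth_on ?TV (\<lambda>y. sec i (fst y))" unfolding V
    by (rule smooth_on_compose[OF oV[unfolded V] open_chart_image _ _ smooth_sec])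
       (auto intro: smooth_on_linear[OF oV[unfolded V] bounded_linear_fst])
  moreover have "smooth_on ?TV (\<lambda>y. frechet_derivative (sec i) (at (fst y)) (snd y))" unfolding V
    by (rule smooth_on_tangent_map[OF open_chart_image smooth_sec])
  ultimately show "smooth_on ?TV (?sec i)" using oV by (intro smooth_on_Pair)
  fix y assume "y \<in> chart_dom ?T i"
  then obtain p v where y: "y = (p, v)" "p \<in> chart_dom M i" "v \<in> tangent_space M p" by (auto simp: dom)
  show "?sec i (chart ?T i y) \<in> E \<times> UNIV" using sec_in[OF y(2)] by (simp add: y ch)
  show "?pr (?sec i (chart ?T i y)) = y"
    using tangent_eq_push[OF y(3,2)] pr_sec[OF y(2)] by (simp add: y ch)
qed

end

lemma open_mfd_cover:
  assumes "open U"
  shows "smooth_cover (open_mfd U) U (\<lambda>x. x) (\<lambda>_ x. x) (\<lambda>_ x. x)"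
  by unfold_locales (use assms in \<open>auto simp: open_mfd_def points_def smooth_on_ident\<close>)

lemma push_open_mfd: "x \<in> U \<Longrightarrow> push (open_mfd U) (\<lambda>x. x) (\<lambda>_ x. x) x u = (\<lambda>_. u)"
  by (simp add: push_def open_mfd_def fun_eq_iff)

section \<open>Projective spaces\<close>

lemma has_derivative_vec_lambda:
  fixes f :: "'m::finite \<Rightarrow> _ \<Rightarrow> 'a::euclidean_space"
  assumes "\<And>i. (f i has_derivative f' i) F"
  shows "((\<lambda>x. \<chi> i. f i x) has_derivative (\<lambda>u. \<chi> i. f' i u)) F"
proof -
  have b: "bounded_linear (axis i :: 'a \<Rightarrow> 'a ^ 'm)" for i :: 'm
    by (intro linear_conv_bounded_linear[THEN iffD1] linearI) (auto simp: axis_def vec_eq_iff)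
  have "((\<lambda>x. \<Sum>i\<in>UNIV. axis i (f i x)) has_derivative (\<lambda>u. \<Sum>i\<in>UNIV. axis i (f' i u))) F"
    by (intro has_derivative_sum bounded_linear.has_derivative[OF b] assms)
  moreover have "(\<Sum>i\<in>UNIV. axis i (g i)) = (\<chi> i. g i)" for g :: "'m \<Rightarrow> 'a"
    by (simp add: vec_eq_iff axis_def if_distrib cong: if_cong)
  ultimately show ?thesis by simp
qed

definition hom_chart :: "'n option \<Rightarrow> 'k::field ^ 'n option \<Rightarrow> 'k ^ 'n" where
  "hom_chart i z = (\<chi> k. z $ skip i k / z $ i)"

text \<open>Insertion of c as i-th coordinate. For \<open>c = 1\<close> this is the affine section of the i-th chart, for \<open>c = 0\<close>
  its linear part. The position of m among the coordinates different from i inverts \<^const>\<open>skip\<close>.\<close>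

definition insert_coord :: "'k \<Rightarrow> 'n option \<Rightarrow> 'k ^ 'n \<Rightarrow> 'k ^ 'n option" where
  "insert_coord c i a = (\<chi> m. if m = i then c else a $ (case m of None \<Rightarrow> the i | Some k \<Rightarrow> k))"

lemma insert_coord_skip [simp]:
  "insert_coord c i a $ skip i k = a $ k" "insert_coord c i a $ i = c"
  by (auto simp: insert_coord_def skip_def)

lemma eq_skipE:
  assumes "m \<noteq> i"
  obtains k where "m = skip i k"
proof
  show "m = skip i (case m of None \<Rightarrow> the i | Some k \<Rightarrow> k)"
    using assms by (auto simp: skip_def split: option.split)
qed

lemma vec_eq_skipI: "z $ i = w $ i \<Longrightarrow> (\<And>k. z $ skip i k = w $ skip i k) \<Longrightarrow> z = w"
  by (metis eq_skipE vec_eq_iff)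

lemma line_def': "line z = range (\<lambda>c. c *s z)"
  by (simp add: line_def vec.span_singleton)

lemma line_eq_iff:
  fixes z w :: "'k::field ^ 'm"
  assumes "z \<noteq> 0"
  shows "line z = line w \<longleftrightarrow> (\<exists>c. c \<noteq> 0 \<and> w = c *s z)"
proof
  assume e: "line z = line w"
  have "w \<in> line z" "z \<in> line w"
    using e vec.span_base[of w "{w}"] vec.span_base[of z "{z}"] by (auto simp: line_def)
  then obtain c d where cd: "w = c *s z" "z = d *s w" unfolding line_def' by blast
  then have "c \<noteq> 0" using assms by auto
  then show "\<exists>c. c \<noteq> 0 \<and> w = c *s z" using cd by auto
next
  assume "\<exists>c. c \<noteq> 0 \<and> w = c *s z"
  then obtain c where c: "c \<noteq> 0" "w = c *s z" by auto
  show "line z = line w"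
  proof
    have "a *s z = (a / c) *s w" for a using c by simp
    then show "line z \<subseteq> line w" by (auto simp: line_def')
    show "line w \<subseteq> line z" using c by (auto simp: line_def' vector_smult_assoc)
  qed
qed

lemma line_scale: "c \<noteq> 0 \<Longrightarrow> line (c *s z) = line z"
  by (cases "z = 0") (simp, metis line_eq_iff)

lemma line_in_chart_dom:
  fixes z :: "'k::field ^ 'n::finite option"
  assumes "z \<noteq> 0"
  shows "line z \<in> chart_dom proj_space i \<longleftrightarrow> z $ i \<noteq> 0"
  unfolding proj_space_def using line_eq_iff[OF assms] by fastforce

lemma affine_rep_line:
  assumes "z $ i \<noteq> 0"
  shows "affine_rep i (line z) = (1 / z $ i) *s z"
  unfolding affine_rep_def line_def'
  by (rule the_equality) (use assms in \<open>auto simp: field_simps\<close>)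

lemma chart_line:
  assumes "z $ i \<noteq> 0"
  shows "chart proj_space i (line z) = hom_chart i z"
  using assms by (simp add: proj_space_def affine_rep_line hom_chart_def vec_eq_iff)

lemma hom_chart_insert [simp]: "hom_chart i (insert_coord 1 i a) = a"
  by (simp add: hom_chart_def vec_eq_iff)

lemma insert_hom_chart:
  fixes z :: "'k::field ^ 'n::finite option"
  assumes "z $ i \<noteq> 0"
  shows "insert_coord 1 i (hom_chart i z) = (1 / z $ i) *s z"
  by (rule vec_eq_skipI[of _ i]) (use assms in \<open>auto simp: hom_chart_def\<close>)

lemma insert_coord_nonzero: "insert_coord 1 i a \<noteq> (0 :: 'k::field ^ 'n::finite option)"
  by (metis insert_coord_skip(2) zero_index zero_neq_one)

lemma proj_chart_image:
  "chart proj_space i ` chart_dom proj_space i = (UNIV :: ('k::field ^ 'n::finite) set)"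
proof -
  have "a \<in> chart proj_space i ` chart_dom proj_space i" for a :: "'k ^ 'n"
  proof (rule image_eqI)
    show "a = chart proj_space i (line (insert_coord 1 i a))" by (simp add: chart_line)
    show "line (insert_coord 1 i a) \<in> chart_dom proj_space i"
      by (simp add: line_in_chart_dom insert_coord_nonzero)
  qed
  then show ?thesis by blast
qed

lemma insert_coord_has_derivative:
  fixes i :: "'n::finite option"
  shows "(insert_coord c i has_derivative (insert_coord 0 i :: 'k::{real_normed_field,euclidean_space} ^ 'n \<Rightarrow> _)) F"
  unfolding insert_coord_def[abs_def]
proof (rule has_derivative_vec_lambda)
  fix m
  show "((\<lambda>x :: 'k ^ 'n. if m = i then c else x $ (case m of None \<Rightarrow> the i | Some k \<Rightarrow> k)) has_derivative
      (\<lambda>u. if m = i then 0 else u $ (case m of None \<Rightarrow> the i | Some k \<Rightarrow> k))) F"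
    by (cases "m = i") (simp_all add: bounded_linear_imp_has_derivative bounded_linear_vec_nth)
qed

lemma frechet_derivative_insert_coord:
  fixes i :: "'n::finite option"
  shows "frechet_derivative (insert_coord c i :: 'k::{real_normed_field,euclidean_space} ^ 'n \<Rightarrow> _) (at a)
    = insert_coord 0 i"
  using frechet_derivative_at[OF insert_coord_has_derivative] by metis

definition dhom_chart :: "'n option \<Rightarrow> 'k::field ^ 'n option \<Rightarrow> 'k ^ 'n option \<Rightarrow> 'k ^ 'n" where
  "dhom_chart i z u = (\<chi> k. (u $ skip i k * z $ i - z $ skip i k * u $ i) / (z $ i * z $ i))"

lemma hom_chart_has_derivative:
  fixes z :: "'k::{real_normed_field,euclidean_space} ^ 'n::finite option"
  assumes "z $ i \<noteq> 0"
  shows "(hom_chart i has_derivative dhom_chart i z) (at z)"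
  unfolding hom_chart_def[abs_def] dhom_chart_def[abs_def]
  by (intro has_derivative_vec_lambda has_derivative_divide' bounded_linear.has_derivative[OF bounded_linear_vec_nth]
        has_derivative_ident assms)

lemma open_nonzero_coord: "open {z :: 'k::real_normed_vector ^ 'm::finite. z $ i \<noteq> 0}"
  by (intro open_Collect_neq continuous_intros)

lemma smooth_on_hom_chart:
  "smooth_on {z :: 'k::{real_normed_field,euclidean_space} ^ 'n::finite option. z $ i \<noteq> 0} (hom_chart i)"
  unfolding hom_chart_def[abs_def]
  by (intro smooth_on_vec smooth_on_divide smooth_on_vec_nth smooth_on_ident open_nonzero_coord) auto

lemma proj_cover:
  "smooth_cover (proj_space :: (('k::{real_normed_field,euclidean_space} ^ 'n option) set, 'n::finite option, 'k ^ 'n) mfd)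
     (- {0}) line hom_chart (insert_coord 1)"
proof
  have over: "{z \<in> - {0}. line z \<in> chart_dom proj_space i} = {z :: 'k ^ 'n option. z $ i \<noteq> 0}" for i
    by (auto simp: line_in_chart_dom) (auto simp: proj_space_def)
  show "line ` (- {0}) = points (proj_space :: (('k ^ 'n option) set, 'n option, 'k ^ 'n) mfd)"
  proof
    show "line ` (- {0}) \<subseteq> points (proj_space :: (('k ^ 'n option) set, 'n option, 'k ^ 'n) mfd)"
    proof (rule image_subsetI)
      fix z :: "'k ^ 'n option" assume "z \<in> - {0}"
      then obtain i where "z $ i \<noteq> 0" by (auto simp: vec_eq_iff)
      then show "line z \<in> points (proj_space :: (('k ^ 'n option) set, 'n option, 'k ^ 'n) mfd)"
        by (auto simp: points_def proj_space_def)
    qed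
    show "points (proj_space :: (('k ^ 'n option) set, 'n option, 'k ^ 'n) mfd) \<subseteq> line ` (- {0})"
    proof
      fix p assume "p \<in> points (proj_space :: (('k ^ 'n option) set, 'n option, 'k ^ 'n) mfd)"
      then obtain i z where "p = line z" "z $ i \<noteq> 0" by (auto simp: points_def proj_space_def)
      moreover from this have "z \<noteq> 0" by auto
      ultimately show "p \<in> line ` (- {0})" by blast
    qed
  qed
  show "open {z \<in> - {0}. line z \<in> chart_dom (proj_space :: (('k ^ 'n option) set, 'n option, 'k ^ 'n) mfd) i}" for i
    unfolding over by (rule open_nonzero_coord)
  show "smooth_on {z \<in> - {0}. line z \<in> chart_dom (proj_space :: (('k ^ 'n option) set, 'n option, 'k ^ 'n) mfd) i} (hom_chart i)" for i
    unfolding over by (rule smooth_on_hom_chart)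
  show "smooth_on (chart proj_space i ` chart_dom proj_space i) (insert_coord 1 i :: 'k ^ 'n \<Rightarrow> _)" for i
  proof -
    have "bounded_linear (insert_coord 0 i :: 'k ^ 'n \<Rightarrow> _)"
      by (rule has_derivative_bounded_linear[OF insert_coord_has_derivative])
    then have "smooth_on UNIV (\<lambda>a. insert_coord 0 i (a :: 'k ^ 'n) + insert_coord 1 i 0)"
      by (intro smooth_on_add smooth_on_linear smooth_on_const) auto
    moreover have "insert_coord 0 i a + insert_coord 1 i 0 = insert_coord 1 i a" for a :: "'k ^ 'n"
      by (auto simp: insert_coord_def vec_eq_iff)
    ultimately show ?thesis by (simp add: proj_chart_image)
  qed
  fix p :: "('k ^ 'n option) set" and i assume "p \<in> chart_dom proj_space i"
  then obtain z where z: "p = line z" "z $ i \<noteq> 0" by (auto simp: proj_space_def)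
  show "line (insert_coord 1 i (chart proj_space i p)) = p"
    using z by (simp add: chart_line insert_hom_chart line_scale)
  show "insert_coord 1 i (chart proj_space i p) \<in> - {0}"
    by (simp add: insert_coord_nonzero)
next
  show "open (- {0 :: 'k ^ 'n option})" by auto
  show "open (chart (proj_space :: (('k ^ 'n option) set, 'n option, 'k ^ 'n) mfd) i ` chart_dom (proj_space :: (('k ^ 'n option) set, 'n option, 'k ^ 'n) mfd) i)" for i
    by (simp add: proj_chart_image)
  show "chart (proj_space :: (('k ^ 'n option) set, 'n option, 'k ^ 'n) mfd) i (line z) = hom_chart i z"
    if "z \<in> - {0}" "line z \<in> chart_dom (proj_space :: (('k ^ 'n option) set, 'n option, 'k ^ 'n) mfd) i" for z i
    using that by (simp add: line_in_chart_dom chart_line)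
qed

abbreviation lpush :: "'k::{real_normed_field,euclidean_space} ^ 'n option \<Rightarrow> 'k ^ 'n option \<Rightarrow> ('n::finite option \<Rightarrow> 'k ^ 'n)" where
  "lpush \<equiv> push proj_space line hom_chart"

lemma lpush_eq:
  assumes "z \<noteq> 0"
  shows "lpush z u = (\<lambda>i. if z $ i \<noteq> 0 then dhom_chart i z u else 0)"
  using frechet_derivative_at[OF hom_chart_has_derivative, of z, symmetric]
  by (auto simp: push_def line_in_chart_dom[OF assms] fun_eq_iff)

lemma lpush_scale:
  assumes "z \<noteq> 0" "c \<noteq> 0"
  shows "lpush (c *s z) (c *s u) = lpush z u"
  using assms by (auto simp: lpush_eq fun_eq_iff dhom_chart_def vec_eq_iff field_simps)

text \<open>The kernel of the differential of the projection onto lines is the line itself.\<close>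

lemma lpush_eq_iff:
  assumes "z \<noteq> 0"
  shows "lpush z u = lpush z w \<longleftrightarrow> (\<exists>c. w = u + c *s z)"
proof
  assume e: "lpush z u = lpush z w"
  obtain i where i: "z $ i \<noteq> 0" using assms by (auto simp: vec_eq_iff)
  have "lpush z u i = lpush z w i" using e by simp
  then have "(u $ skip i k * z $ i - z $ skip i k * u $ i) = (w $ skip i k * z $ i - z $ skip i k * w $ i)" for k
    using i by (simp add: lpush_eq[OF assms] dhom_chart_def vec_eq_iff)
  then have "w = u + ((w $ i - u $ i) / z $ i) *s z"
    by (intro vec_eq_skipI[of _ i]) (use i in \<open>simp_all add: field_simps\<close>)
  then show "\<exists>c. w = u + c *s z" by blast
next
  assume "\<exists>c. w = u + c *s z"
  then show "lpush z u = lpush z w"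
    by (auto simp: lpush_eq[OF assms] dhom_chart_def vec_eq_iff fun_eq_iff algebra_simps)
qed

text \<open>The ambiguity of lifts: the base point may be rescaled by c, and a representative is then rescaled by c
  and changed by a multiple of the base point.\<close>

lemma lpush_lift_unique:
  assumes "z \<noteq> 0" "z' \<noteq> 0" "line z = line z'"
  obtains c where "c \<noteq> 0" "z' = c *s z"
    "\<And>u u'. lpush z u = lpush z' u' \<Longrightarrow> \<exists>d. u' = c *s u + d *s z"
proof -
  obtain c where c: "c \<noteq> 0" "z' = c *s z" using assms line_eq_iff by blast
  moreover have "\<exists>d. u' = c *s u + d *s z" if "lpush z u = lpush z' u'" for u u'
  proof -
    have "lpush z' (c *s u) = lpush z' u'" using that c lpush_scale[OF assms(1)] by simp
    then obtain d where "u' = c *s u + d *s z'" using lpush_eq_iff[OF assms(2)] by blast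
    then show ?thesis using c by (auto simp: vector_smult_assoc)
  qed
  ultimately show ?thesis using that by blast
qed

section \<open>The Fubini--Study form and metric in homogeneous coordinates\<close>

lemma herm_add_left: "herm (u + v) w = herm u w + herm v w"
  and herm_add_right: "herm u (v + w) = herm u v + herm u w"
  and herm_minus_left: "herm (- u) w = - herm u w"
  and herm_scale_left: "herm (a *s u) w = cnj a * herm u w"
  and herm_scale_right: "herm u (a *s w) = a * herm u w"
  by (simp_all add: herm_def sum.distrib sum_distrib_left sum_negf algebra_simps)

lemma herm_self: "herm z z = complex_of_real ((norm z)\<^sup>2)"
proof -
  have "(norm z)\<^sup>2 = (\<Sum>i\<in>UNIV. (cmod (z $ i))\<^sup>2)"
    by (simp add: norm_vec_def L2_set_def sum_nonneg)
  then show ?thesis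
    by (simp add: herm_def complex_norm_square mult.commute del: of_real_power)
qed

text \<open>The pullback of \<^term>\<open>fs_form c\<close> to the nonzero vectors.\<close>

definition fs_lift :: "real \<Rightarrow> complex ^ 'm \<Rightarrow> complex ^ 'm \<Rightarrow> complex ^ 'm::finite \<Rightarrow> real" where
  "fs_lift c z u w = c * Im (herm z z * herm u w - herm u z * herm z w) / (norm z) ^ 4"

lemma norm_scale4: "norm (a *s z) ^ 4 = (cmod a) ^ 4 * (norm z) ^ 4" for z :: "complex ^ 'm::finite"
proof -
  have "complex_of_real ((norm (a *s z))\<^sup>2) = complex_of_real ((cmod a)\<^sup>2 * (norm z)\<^sup>2)"
    by (simp only: herm_self[symmetric] herm_scale_left herm_scale_right of_real_mult complex_norm_square)
      (simp add: herm_self algebra_simps)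
  then have "(norm (a *s z))\<^sup>2 = (cmod a)\<^sup>2 * (norm z)\<^sup>2" by (simp only: of_real_eq_iff)
  then have "((norm (a *s z))\<^sup>2)\<^sup>2 = ((cmod a)\<^sup>2)\<^sup>2 * ((norm z)\<^sup>2)\<^sup>2" by (simp add: power_mult_distrib)
  then show ?thesis by (simp flip: power_mult)
qed

text \<open>The real number in the definition of \<^const>\<open>fs_form\<close> does not depend on the lift: numerator and
  denominator both scale by \<open>\<bar>a\<bar>\<^sup>4\<close>, and the multiples of z cancel as in a Gram determinant.\<close>

lemma fs_lift_invariant:
  assumes "a \<noteq> 0"
  shows "fs_lift c (a *s z) (a *s u + m *s z) (a *s w + n *s z) = fs_lift c z u w"
proof -
  let ?k = "cnj a * a"
  have k: "?k = complex_of_real ((cmod a)\<^sup>2)" by (subst complex_norm_square) (rule mult.commute)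
  have "herm (a *s z) (a *s z) * herm (a *s u + m *s z) (a *s w + n *s z)
      - herm (a *s u + m *s z) (a *s z) * herm (a *s z) (a *s w + n *s z)
      = ?k\<^sup>2 * (herm z z * herm u w - herm u z * herm z w)"
    unfolding herm_add_left herm_add_right herm_scale_left herm_scale_right by algebra
  also have "?k\<^sup>2 = complex_of_real ((cmod a) ^ 4)"
    unfolding k by (simp flip: of_real_power power_mult)
  finally show ?thesis
    using assms by (simp add: fs_lift_def norm_scale4)
qed

lemma dproj_eq:
  fixes z :: "complex ^ 'n::finite option"
  assumes "z \<noteq> 0"
  shows "dproj z u = lpush z u"
proof -
  have o: "open (- {0 :: complex ^ 'n option})" by auto
  have "differential (open_mfd (- {0})) CP line z (push (open_mfd (- {0})) (\<lambda>x. x) (\<lambda>_ x. x) z u) = lpush z u"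
    by (rule differential_push_global[OF open_mfd_cover[OF o] proj_cover, of "\<lambda>x. x"])
      (use assms o in \<open>auto simp: smooth_on_ident\<close>)
  then show ?thesis using assms by (simp add: push_open_mfd dproj_def)
qed

lemma fs_form_line:
  assumes "z \<noteq> 0"
  shows "fs_form c (line z) (lpush z u) (lpush z w) = fs_lift c z u w"
  unfolding fs_form_def fs_lift_def[symmetric]
proof (rule the_equality)
  show "\<exists>z' u' w'. z' \<noteq> 0 \<and> line z = line z' \<and> lpush z u = dproj z' u' \<and> lpush z w = dproj z' w' \<and>
      fs_lift c z u w = fs_lift c z' u' w'"
    using assms dproj_eq by metis
  fix r assume "\<exists>z' u' w'. z' \<noteq> 0 \<and> line z = line z' \<and> lpush z u = dproj z' u' \<and> lpush z w = dproj z' w' \<and>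
      r = fs_lift c z' u' w'"
  then obtain z' u' w' where *: "z' \<noteq> 0" "line z = line z'" "lpush z u = dproj z' u'" "lpush z w = dproj z' w'"
      "r = fs_lift c z' u' w'" by blast
  obtain a where a: "a \<noteq> 0" "z' = a *s z" "\<And>u u'. lpush z u = lpush z' u' \<Longrightarrow> \<exists>d. u' = a *s u + d *s z"
    by (rule lpush_lift_unique[OF assms *(1,2)]) blast
  then obtain m n where "u' = a *s u + m *s z" "w' = a *s w + n *s z"
    using * dproj_eq[OF *(1)] by metis
  then show "r = fs_lift c z u w" using *(5) a fs_lift_invariant by metis
qed

definition cvec :: "real ^ 'm \<Rightarrow> complex ^ 'm" where
  "cvec x = (\<chi> i. complex_of_real (x $ i))"

lemma cvec_simps:
  "cvec (r *s x) = complex_of_real r *s cvec x"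
  "cvec (x + y) = cvec x + cvec y"
  "cvec x = cvec y \<longleftrightarrow> x = y"
  "cvec x = 0 \<longleftrightarrow> x = 0"
  by (auto simp: cvec_def vec_eq_iff)

lemma bounded_linear_cvec: "bounded_linear (cvec :: real ^ 'm::finite \<Rightarrow> complex ^ 'm)"
  by (intro linear_conv_bounded_linear[THEN iffD1] linearI)
    (auto simp: cvec_def vec_eq_iff complex_eq_iff)

lemma herm_cvec: "herm (cvec x) (cvec y) = complex_of_real (x \<bullet> y)"
  by (simp add: herm_def cvec_def inner_vec_def)

lemma norm_cvec: "norm (cvec x) = norm x"
  using herm_self[of "cvec x"] herm_cvec[of x x]
  by (metis of_real_eq_iff norm_ge_zero power2_eq_iff_nonneg power2_norm_eq_inner)

lemma RP_to_CP_line: "RP_to_CP (line x) = line (cvec x)"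
proof -
  have "RP_to_CP (line x) = vec.span (cvec ` line x)" by (simp add: RP_to_CP_def cvec_def)
  also have "\<dots> = line (cvec x)"
  proof
    have "cvec ` line x \<subseteq> line (cvec x)"
      unfolding line_def' by (auto simp: cvec_simps)
    then show "vec.span (cvec ` line x) \<subseteq> line (cvec x)"
      unfolding line_def using vec.span_minimal vec.subspace_span by blast
    have "x \<in> line x" unfolding line_def by (simp add: vec.span_base)
    then show "line (cvec x) \<subseteq> vec.span (cvec ` line x)"
      unfolding line_def by (intro vec.span_mono) auto
  qed
  finally show ?thesis .
qed

lemma differential_RP_to_CP:
  assumes "x \<noteq> 0"
  shows "differential RP CP RP_to_CP (line x) (lpush x u) = lpush (cvec x) (cvec u)"
  by (rule differential_push_global[OF proj_cover proj_cover, of cvec])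
    (use assms in \<open>auto simp: bounded_linear_cvec cvec_simps RP_to_CP_line
      bounded_linear_imp_has_derivative intro: smooth_on_linear\<close>)

lemma CP_J_lpush:
  assumes "z \<noteq> 0"
  shows "(\<lambda>i. - CP_J (lpush z u) i) = lpush z ((- \<i>) *s u)"
  by (auto simp: CP_J_def lpush_eq[OF assms] fun_eq_iff vec_eq_iff dhom_chart_def algebra_simps
      minus_divide_left)

text \<open>Inserting \<open>- \<i> u\<close> turns the imaginary part into the real part, and all Hermitian products of real
  vectors are real.\<close>

lemma RP_metric_line:
  assumes "x \<noteq> 0"
  shows "RP_metric c (line x) (lpush x u) (lpush x w)
    = c * ((x \<bullet> x) * (u \<bullet> w) - (u \<bullet> x) * (x \<bullet> w)) / (norm x) ^ 4"
proof -
  have "cvec x \<noteq> 0" using assms by (simp add: cvec_simps)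
  note * = fs_form_line[OF this] CP_J_lpush[OF this]
  show ?thesis
    by (simp add: RP_metric_def differential_RP_to_CP[OF assms] RP_to_CP_line fs_metric_def * fs_lift_def
       herm_scale_left herm_minus_left herm_cvec norm_cvec)
qed

section \<open>The area of a projective line\<close>

lemma line_area_integrand:
  fixes k :: "'n::finite"
  shows "fs_form c (coord_line k \<zeta>)
          (differential (open_mfd UNIV) CP (coord_line k) \<zeta> (\<lambda>_. 1))
          (differential (open_mfd UNIV) CP (coord_line k) \<zeta> (\<lambda>_. \<i>)) = c / (1 + (cmod \<zeta>)\<^sup>2)\<^sup>2"
proof -
  let ?e = "axis None 1 :: complex ^ 'n option" and ?f = "axis (Some k) 1 :: complex ^ 'n option"
  let ?h = "\<lambda>\<zeta>. ?e + \<zeta> *s ?f"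
  have nz: "?h \<zeta> \<noteq> 0" for \<zeta> by (auto simp: vec_eq_iff axis_def)
  have lin: "bounded_linear (\<lambda>\<zeta>. \<zeta> *s ?f)"
    by (intro linear_conv_bounded_linear[THEN iffD1] linearI) (auto simp: vec_eq_iff algebra_simps)
  have d: "(?h has_derivative (\<lambda>u. u *s ?f)) (at \<zeta>)"
    using has_derivative_add[OF has_derivative_const bounded_linear_imp_has_derivative[OF lin], of ?e] by simp
  have dif: "differential (open_mfd UNIV) CP (coord_line k) \<zeta> (\<lambda>_. u) = lpush (?h \<zeta>) (u *s ?f)" for u
  proof -
    have "smooth_on UNIV ?h"
      by (intro smooth_on_add smooth_on_const smooth_on_linear lin) auto
    then have "differential (open_mfd UNIV) CP (coord_line k) \<zeta> (push (open_mfd UNIV) (\<lambda>x. x) (\<lambda>_ x. x) \<zeta> u)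
        = lpush (?h \<zeta>) (u *s ?f)"
      by (rule differential_push_global[OF open_mfd_cover[OF open_UNIV] proj_cover _ _ _ _ d])
        (use nz in \<open>auto simp: coord_line_def\<close>)
    then show ?thesis by (simp add: push_open_mfd)
  qed
  have h: "herm ?e ?e = 1" "herm ?f ?f = 1" "herm ?e ?f = 0" "herm ?f ?e = 0"
    by (simp_all add: herm_def axis_def if_distrib cong: if_cong) (auto intro!: sum.neutral)
  have n: "complex_of_real ((norm (?h \<zeta>))\<^sup>2) = complex_of_real (1 + (cmod \<zeta>)\<^sup>2)"
    unfolding herm_self[symmetric] herm_add_left herm_add_right herm_scale_left herm_scale_right h
    by (simp add: complex_norm_square mult.commute del: of_real_power)
  then have n: "(norm (?h \<zeta>))\<^sup>2 = 1 + (cmod \<zeta>)\<^sup>2" by (simp only: of_real_eq_iff)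
  then have "((norm (?h \<zeta>))\<^sup>2)\<^sup>2 = (1 + (cmod \<zeta>)\<^sup>2)\<^sup>2" by simp
  then have n4: "norm (?h \<zeta>) ^ 4 = (1 + (cmod \<zeta>)\<^sup>2)\<^sup>2" by (simp flip: power_mult)
  have "herm (?h \<zeta>) (?h \<zeta>) * herm (1 *s ?f) (\<i> *s ?f) - herm (1 *s ?f) (?h \<zeta>) * herm (?h \<zeta>) (\<i> *s ?f) = \<i>"
    unfolding herm_add_left herm_add_right herm_scale_left herm_scale_right h by (simp add: algebra_simps)
  then have "fs_lift c (?h \<zeta>) (1 *s ?f) (\<i> *s ?f) = c / (1 + (cmod \<zeta>)\<^sup>2)\<^sup>2"
    unfolding fs_lift_def n4 by simp
  then show ?thesis unfolding dif coord_line_def using fs_form_line[OF nz] by metis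
qed

text \<open>The integrand is the integral of \<open>4 s / (1 + s\<^sup>2)\<^sup>3\<close> over \<open>s \<ge> \<bar>\<zeta>\<bar>\<close>. Exchanging the integrals reduces the
  claim to the area \<open>\<pi> s\<^sup>2\<close> of a disc and to a one-dimensional integral.\<close>

lemma nn_integral_fs_density:
  "(\<integral>\<^sup>+ \<zeta>. ennreal (1 / (1 + (cmod \<zeta>)\<^sup>2)\<^sup>2) \<partial>lborel) = ennreal pi"
proof -
  let ?f = "\<lambda>s :: real. 4 * s / (1 + s\<^sup>2) ^ 3"
  have pos: "1 + s\<^sup>2 \<noteq> 0" for s :: real
    by (metis add_pos_nonneg less_irrefl zero_le_power2 zero_less_one)
  have [measurable]: "?f \<in> borel_measurable borel" by measurable
  have ind: "indicator {cmod \<zeta>..} s = (indicator (cball 0 s) \<zeta> :: ennreal)" for \<zeta> s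
    by (auto simp: indicator_def)
  have inner: "ennreal (1 / (1 + (cmod \<zeta>)\<^sup>2)\<^sup>2) = (\<integral>\<^sup>+ s. ennreal (?f s) * indicator (cball 0 s) \<zeta> \<partial>lborel)" for \<zeta>
  proof -
    have "(\<integral>\<^sup>+ s. ennreal (?f s) * indicator {cmod \<zeta>..} s \<partial>lborel)
        = ennreal (0 - (- (1 / (1 + (cmod \<zeta>)\<^sup>2)\<^sup>2)))"
    proof (rule nn_integral_FTC_atLeast)
      fix s assume "cmod \<zeta> \<le> s"
      then have "0 \<le> s" using norm_ge_zero order_trans by blast
      then show "0 \<le> ?f s" by simp
      show "DERIV (\<lambda>s. - (1 / (1 + s\<^sup>2)\<^sup>2)) s :> ?f s"
      proof -
        have e: "- ((0 * W\<^sup>2 - 1 * (2 * W * (2 * s))) / (W\<^sup>2 * W\<^sup>2)) = 4 * s / W ^ 3" if "W \<noteq> 0" for W :: real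
          using that by (simp add: field_simps power2_eq_square power3_eq_cube)
        show ?thesis
          unfolding e[OF pos, symmetric]
          by (rule derivative_eq_intros refl)+ (use pos[of s] in \<open>simp_all add: algebra_simps\<close>)
      qed
    next
      show "((\<lambda>s::real. - (1 / (1 + s\<^sup>2)\<^sup>2)) \<longlongrightarrow> 0) at_top" by real_asymp
    qed simp
    then show ?thesis by (simp add: ind)
  qed
  have m: "(\<lambda>(\<zeta> :: complex, s). ennreal (?f s) * indicator (cball 0 s) \<zeta>) \<in> borel_measurable (lborel \<Otimes>\<^sub>M lborel)"
  proof -
    have "(\<lambda>(\<zeta> :: complex, s). ennreal (?f s) * indicator {y. cmod (fst y) \<le> snd y} (\<zeta>, s)) \<in> borel_measurable (lborel \<Otimes>\<^sub>M lborel)"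
      by measurable
    then show ?thesis by (simp add: indicator_def)
  qed
  have "(\<integral>\<^sup>+ \<zeta>. ennreal (1 / (1 + (cmod \<zeta>)\<^sup>2)\<^sup>2) \<partial>lborel)
      = (\<integral>\<^sup>+ s. (\<integral>\<^sup>+ \<zeta>. ennreal (?f s) * indicator (cball 0 s) (\<zeta> :: complex) \<partial>lborel) \<partial>lborel)"
    unfolding inner using lborel_pair.Fubini'[OF m] by simp
  also have "\<dots> = (\<integral>\<^sup>+ s. ennreal (4 * pi * s ^ 3 / (1 + s\<^sup>2) ^ 3) * indicator {0..} s \<partial>lborel)"
  proof (rule nn_integral_cong)
    fix s :: real
    have "emeasure lborel (cball (0::complex) s) = ennreal (pi * s\<^sup>2)" if "0 \<le> s"
      using that by (simp add: emeasure_cball unit_ball_vol_2)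
    moreover have "?f s * (pi * s\<^sup>2) = 4 * pi * s ^ 3 / (1 + s\<^sup>2) ^ 3"
      by (simp add: power2_eq_square power3_eq_cube)
    ultimately show "(\<integral>\<^sup>+ \<zeta>. ennreal (?f s) * indicator (cball 0 s) (\<zeta> :: complex) \<partial>lborel)
        = ennreal (4 * pi * s ^ 3 / (1 + s\<^sup>2) ^ 3) * indicator {0..} s"
      by (cases "0 \<le> s") (simp_all add: nn_integral_cmult_indicator flip: ennreal_mult')
  qed
  also have "\<dots> = ennreal (pi - (\<lambda>s. pi * (1 - 1 / (1 + s\<^sup>2))\<^sup>2) 0)"
  proof (rule nn_integral_FTC_atLeast)
    fix s :: real assume "0 \<le> s"
    then show "0 \<le> 4 * pi * s ^ 3 / (1 + s\<^sup>2) ^ 3" by simp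
    show "DERIV (\<lambda>s. pi * (1 - 1 / (1 + s\<^sup>2))\<^sup>2) s :> 4 * pi * s ^ 3 / (1 + s\<^sup>2) ^ 3"
    proof -
      have e: "pi * (2 * (1 - 1 / W) * (2 * s / (W * W))) = 4 * pi * (s * (W - 1)) / W ^ 3" if "W \<noteq> 0" for W :: real
        using that by (simp add: field_simps power3_eq_cube)
      have "s ^ 3 = s * ((1 + s\<^sup>2) - 1)" by (simp add: power2_eq_square power3_eq_cube)
      then have v: "4 * pi * s ^ 3 / (1 + s\<^sup>2) ^ 3 = pi * (2 * (1 - 1 / (1 + s\<^sup>2)) * (2 * s / ((1 + s\<^sup>2) * (1 + s\<^sup>2))))"
        using e[OF pos] by simp
      have "DERIV (\<lambda>W. pi * (1 - 1 / W)\<^sup>2) W :> pi * (2 * (1 - 1 / W) * (1 / (W * W)))" if "W \<noteq> 0" for W :: real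
        using that by (auto intro!: derivative_eq_intros)
      note G = this
      have "DERIV (\<lambda>s. 1 + s\<^sup>2) s :> 2 * s" by (auto intro!: derivative_eq_intros)
      from DERIV_chain2[where f = "\<lambda>W. pi * (1 - 1 / W)\<^sup>2" and g = "\<lambda>s. 1 + s\<^sup>2", OF G[OF pos] this]
      show ?thesis unfolding v by (simp add: mult.assoc)
    qed
  next
    show "((\<lambda>s::real. pi * (1 - 1 / (1 + s\<^sup>2))\<^sup>2) \<longlongrightarrow> pi) at_top" by real_asymp
  qed simp
  finally show ?thesis by simp
qed

lemma line_area_fs_form: "line_area (fs_form c) k = c * pi"
proof -
  have "(LINT \<zeta>|lborel. 1 / (1 + (cmod \<zeta>)\<^sup>2)\<^sup>2) = pi"
    by (subst integral_eq_nn_integral) (simp_all add: nn_integral_fs_density)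
  moreover have "(LINT \<zeta>|lborel. c / (1 + (cmod \<zeta>)\<^sup>2)\<^sup>2) = (LINT \<zeta>|lborel. c * (1 / (1 + (cmod \<zeta>)\<^sup>2)\<^sup>2))"
    by simp
  ultimately show ?thesis
    unfolding line_area_def line_area_integrand by (simp only: integral_mult_right_zero)
qed

section \<open>The polar lift\<close>

text \<open>The derivative of \<^const>\<open>sgn\<close> at x in direction u, that is the component of u orthogonal to x divided by the
  length of x.\<close>

definition dsgn :: "'a::real_inner \<Rightarrow> 'a \<Rightarrow> 'a" where
  "dsgn x u = inverse (norm x) *\<^sub>R u - ((inverse (norm x)) ^ 3 * (u \<bullet> x)) *\<^sub>R x"

lemma inverse_norm_power:
  assumes "x \<noteq> 0"
  shows "(inverse (norm x)) ^ 3 * (x \<bullet> x) = inverse (norm x)"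
  using assms by (simp add: power3_eq_cube dot_square_norm power2_eq_square field_simps)

lemma dsgn_orthogonal: "x \<noteq> 0 \<Longrightarrow> dsgn x u \<bullet> x = 0"
  using inverse_norm_power[of x] by (simp add: dsgn_def inner_diff_left mult.assoc mult.left_commute)

lemma dsgn_inner_dsgn:
  assumes "x \<noteq> 0"
  shows "dsgn x u \<bullet> dsgn x w = ((x \<bullet> x) * (u \<bullet> w) - (u \<bullet> x) * (x \<bullet> w)) / (norm x) ^ 4"
proof -
  define r where "r = inverse (norm x)"
  have r: "r * norm x = 1" using assms by (simp add: r_def)
  have "dsgn x u \<bullet> dsgn x w = dsgn x u \<bullet> (r *\<^sub>R w)"
    using dsgn_orthogonal[OF assms, of u] by (simp add: dsgn_def[of x w] inner_diff_right r_def)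
  also have "\<dots> = r\<^sup>2 * (u \<bullet> w) - r ^ 4 * (u \<bullet> x) * (x \<bullet> w)"
    by (simp add: dsgn_def r_def[symmetric] inner_diff_left power2_eq_square power3_eq_cube power4_eq_xxxx algebra_simps)
  also have "\<dots> = r ^ 4 * ((x \<bullet> x) * (u \<bullet> w) - (u \<bullet> x) * (x \<bullet> w))"
  proof -
    have "r\<^sup>2 = r ^ 4 * (x \<bullet> x)"
      using r unfolding dot_square_norm by algebra
    then show ?thesis by (simp add: algebra_simps)
  qed
  finally show ?thesis by (simp add: r_def divide_inverse power_inverse mult.commute)
qed

lemma inverse_norm_has_derivative:
  assumes "x \<noteq> 0"
  shows "((\<lambda>x. inverse (norm x)) has_derivative (\<lambda>h. - ((inverse (norm x)) ^ 3) * (x \<bullet> h))) (at x)"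
proof -
  have "((\<lambda>x. inverse (norm x)) has_derivative (\<lambda>h. - (inverse (norm x) * (sgn x \<bullet> h) * inverse (norm x)))) (at x)"
    using assms has_derivative_norm[OF assms]
    by (intro Deriv.has_derivative_inverse) (auto simp: inner_commute)
  moreover have "- (inverse (norm x) * (sgn x \<bullet> h) * inverse (norm x)) = - ((inverse (norm x)) ^ 3) * (x \<bullet> h)" for h
    by (simp add: sgn_div_norm power3_eq_cube divide_inverse)
  ultimately show ?thesis by simp
qed

lemma sgn_has_derivative:
  assumes "x \<noteq> 0"
  shows "(sgn has_derivative dsgn x) (at x)"
proof -
  have "((\<lambda>x. inverse (norm x) *\<^sub>R x) has_derivative
     (\<lambda>h. inverse (norm x) *\<^sub>R h + (- ((inverse (norm x)) ^ 3) * (x \<bullet> h)) *\<^sub>R x)) (at x)"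
    by (intro has_derivative_scaleR inverse_norm_has_derivative[OF assms] has_derivative_ident)
  moreover have "(\<lambda>h. inverse (norm x) *\<^sub>R h + (- ((inverse (norm x)) ^ 3) * (x \<bullet> h)) *\<^sub>R x) = dsgn x"
    by (auto simp: dsgn_def inner_commute)
  moreover have "sgn = (\<lambda>x :: 'a. inverse (norm x) *\<^sub>R x)" by (auto simp: sgn_div_norm)
  ultimately show ?thesis by simp
qed

text \<open>The symmetric map S is the second derivative of \<^const>\<open>sgn\<close>; being symmetric, it cancels in
  exterior derivatives.\<close>

lemma dsgn_has_derivative_symmetric:
  assumes "x \<noteq> 0"
  obtains S where "\<And>u. ((\<lambda>x. dsgn x u) has_derivative S u) (at x)" "\<And>u w. S u w = S w u"
proof
  let ?r = "inverse (norm x)"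
  define S where "S = (\<lambda>u h. (- (?r ^ 3) * (x \<bullet> h)) *\<^sub>R u -
      ((?r ^ 3 * (u \<bullet> x)) *\<^sub>R h + (?r ^ 3 * (u \<bullet> h) + (3 * (- (?r ^ 3) * (x \<bullet> h)) * ?r\<^sup>2) * (u \<bullet> x)) *\<^sub>R x))"
  note d = inverse_norm_has_derivative[OF assms]
  show "((\<lambda>x. dsgn x u) has_derivative S u) (at x)" for u
    unfolding dsgn_def[abs_def] S_def
    by (rule derivative_eq_intros d refl)+ (simp add: fun_eq_iff)
  show "S u w = S w u" for u w
    by (simp add: S_def inner_commute algebra_simps)
qed

text \<open>The larger root f of \<open>f\<^sup>2 + q / f\<^sup>2 = 1\<close>.\<close>

definition rad :: "real \<Rightarrow> real" where
  "rad q = sqrt ((1 + sqrt (1 - 4 * q)) / 2)"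

lemma rad_props:
  assumes "4 * q < 1"
  shows "rad q > 0" "2 * (rad q)\<^sup>2 - 1 = sqrt (1 - 4 * q)" "(rad q)\<^sup>2 * (1 - (rad q)\<^sup>2) = q"
proof -
  have s: "sqrt (1 - 4 * q) > 0" "(sqrt (1 - 4 * q))\<^sup>2 = 1 - 4 * q" using assms by auto
  then show "rad q > 0" by (simp add: rad_def add_pos_pos)
  have r2: "(rad q)\<^sup>2 = (1 + sqrt (1 - 4 * q)) / 2" using s by (simp add: rad_def)
  then show "2 * (rad q)\<^sup>2 - 1 = sqrt (1 - 4 * q)" by simp
  show "(rad q)\<^sup>2 * (1 - (rad q)\<^sup>2) = q"
    unfolding r2 using s(2) by (simp add: field_simps power2_eq_square)
qed

text \<open>This is \<open>d(h / f) \<and> d(f s) = dh \<and> ds\<close> evaluated on two vectors v and w, with \<open>sv\<close>, \<open>hv\<close>, \<open>fv\<close> the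
  derivatives along v. The last two hypotheses are the derivative of \<open>h \<bullet> s = 0\<close>; by them the terms
  that contain \<open>df\<close> are symmetric in v and w.\<close>

lemma polar_identity:
  fixes s h sv sw hv hw :: "'a::real_inner"
  assumes "f \<noteq> 0" "h \<bullet> s = 0"
    and "hv \<bullet> s = - (h \<bullet> sv)" "hw \<bullet> s = - (h \<bullet> sw)"
  shows "(inverse f *\<^sub>R hv - (fv * inverse f * inverse f) *\<^sub>R h) \<bullet> (f *\<^sub>R sw + fw *\<^sub>R s)
    - (f *\<^sub>R sv + fv *\<^sub>R s) \<bullet> (inverse f *\<^sub>R hw - (fw * inverse f * inverse f) *\<^sub>R h)
    = hv \<bullet> sw - hw \<bullet> sv"
proof -
  have e: "(inverse f *\<^sub>R hv - (fv * inverse f * inverse f) *\<^sub>R h) \<bullet> (f *\<^sub>R sw + fw *\<^sub>R s)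
      = hv \<bullet> sw - inverse f * (fw * (h \<bullet> sv) + fv * (h \<bullet> sw))"
    if "hv \<bullet> s = - (h \<bullet> sv)" for hv sv sw fv fw
  proof -
    have "(inverse f *\<^sub>R hv - (fv * inverse f * inverse f) *\<^sub>R h) \<bullet> (f *\<^sub>R sw + fw *\<^sub>R s)
        = (inverse f * f) * (hv \<bullet> sw) + inverse f * fw * (hv \<bullet> s) - fv * inverse f * (inverse f * f) * (h \<bullet> sw)
          - fv * inverse f * inverse f * fw * (h \<bullet> s)"
      by (simp only: inner_diff_left inner_add_right inner_scaleR_left inner_scaleR_right) algebra
    then show ?thesis using assms(1,2) that by (simp add: algebra_simps)
  qed
  show ?thesis
    unfolding inner_commute[of "f *\<^sub>R sv + fv *\<^sub>R s"] e[OF assms(3)] e[OF assms(4)] by simp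
qed

definition cplx :: "real ^ 'm \<Rightarrow> real ^ 'm \<Rightarrow> complex ^ 'm" where
  "cplx a b = (\<chi> i. Complex (a $ i) (b $ i))"

lemma cplx_inject: "cplx a b = cplx a' b' \<longleftrightarrow> a = a' \<and> b = b'"
  by (auto simp: cplx_def vec_eq_iff)

lemma cplx_scale: "complex_of_real r *s cplx a b = cplx (r *\<^sub>R a) (r *\<^sub>R b)"
  by (simp add: cplx_def vec_eq_iff complex_eq_iff)

lemma herm_cplx: "herm (cplx a b) (cplx c d) = Complex (a \<bullet> c + b \<bullet> d) (a \<bullet> d - b \<bullet> c)"
  by (simp add: herm_def cplx_def inner_vec_def complex_eq_iff sum.distrib sum_subtractf)

lemma norm_cplx: "(norm (cplx a b))\<^sup>2 = a \<bullet> a + b \<bullet> b"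
  using herm_self[of "cplx a b"] by (simp add: herm_cplx complex_eq_iff)

lemma bounded_linear_cplx: "bounded_linear (\<lambda>p. cplx (fst p) (snd p) :: complex ^ 'm::finite)"
  by (intro linear_conv_bounded_linear[THEN iffD1] linearI) (auto simp: cplx_def vec_eq_iff complex_eq_iff)

definition qform :: "complex ^ 'm::finite \<Rightarrow> complex" where
  "qform z = (\<Sum>i\<in>UNIV. (z $ i)\<^sup>2)"

lemma qform_scale: "qform (a *s z) = a\<^sup>2 * qform z"
  by (simp add: qform_def power_mult_distrib sum_distrib_left)

lemma qform_cplx: "qform (cplx a b) = Complex (a \<bullet> a - b \<bullet> b) (2 * (a \<bullet> b))"
  by (simp add: qform_def cplx_def inner_vec_def complex_eq_iff power2_eq_square sum_subtractf sum_distrib_left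
      sum.distrib mult.commute)

lemma line_in_quadric_iff:
  assumes "z \<noteq> 0"
  shows "line z \<in> quadric \<longleftrightarrow> qform z = 0"
proof
  assume "line z \<in> quadric"
  then obtain w where w: "line z = line w" "qform w = 0" by (auto simp: quadric_def qform_def)
  then obtain c where "c \<noteq> 0" "w = c *s z" using line_eq_iff[OF assms] by blast
  then show "qform z = 0" using w by (simp add: qform_scale)
qed (use assms in \<open>auto simp: quadric_def qform_def\<close>)

text \<open>The pairs that represent tangent vectors in the open unit disc bundle.\<close>

definition disc_lift :: "('a::real_inner \<times> 'a) set" where
  "disc_lift = {z. fst z \<noteq> 0 \<and> 4 * (dsgn (fst z) (snd z) \<bullet> dsgn (fst z) (snd z)) < 1}"

definition lift_rad :: "'a::real_inner \<times> 'a \<Rightarrow> real" where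
  "lift_rad z = rad (dsgn (fst z) (snd z) \<bullet> dsgn (fst z) (snd z))"

text \<open>The vector \<open>f s - \<i> h / f\<close> of the introduction, with s and h given by \<^const>\<open>sgn\<close> and
  \<^const>\<open>dsgn\<close>.\<close>

definition polar_lift :: "(real ^ 'm) \<times> (real ^ 'm) \<Rightarrow> complex ^ 'm::finite" where
  "polar_lift z = cplx (lift_rad z *\<^sub>R sgn (fst z)) (- (inverse (lift_rad z) *\<^sub>R dsgn (fst z) (snd z)))"

lemma open_fst_nonzero: "open {z :: 'a::real_normed_vector \<times> 'a. fst z \<noteq> 0}"
  by (intro open_Collect_neq continuous_intros)

lemma smooth_on_inverse_norm_fst:
  "smooth_on {z :: 'a::euclidean_space \<times> 'a. fst z \<noteq> 0} (\<lambda>z. inverse (norm (fst z)))"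
  unfolding norm_eq_sqrt_inner
  by (intro smooth_on_inverse smooth_on_sqrt smooth_on_inner smooth_on_fst smooth_on_ident open_fst_nonzero) auto

lemma smooth_on_dsgn:
  "smooth_on {z :: 'a::euclidean_space \<times> 'a. fst z \<noteq> 0} (\<lambda>z. dsgn (fst z) (snd z))"
  unfolding dsgn_def power3_eq_cube
  by (intro smooth_on_diff smooth_on_scaleR smooth_on_mult smooth_on_inner smooth_on_inverse_norm_fst
      smooth_on_fst smooth_on_snd smooth_on_ident open_fst_nonzero)

lemma smooth_on_sgn_fst:
  "smooth_on {z :: 'a::euclidean_space \<times> 'a. fst z \<noteq> 0} (\<lambda>z. sgn (fst z))"
  unfolding sgn_div_norm
  by (intro smooth_on_scaleR smooth_on_inverse_norm_fst smooth_on_fst smooth_on_ident open_fst_nonzero)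

lemma open_disc_lift: "open (disc_lift :: ('a::euclidean_space \<times> 'a) set)"
proof -
  have "continuous_on {z :: 'a \<times> 'a. fst z \<noteq> 0} (\<lambda>z. 4 * (dsgn (fst z) (snd z) \<bullet> dsgn (fst z) (snd z)))"
    by (intro continuous_intros smooth_on_imp_continuous_on smooth_on_dsgn)
  from continuous_open_preimage[OF this open_fst_nonzero open_lessThan[of 1]]
  show ?thesis by (simp add: disc_lift_def vimage_def Collect_conj_eq)
qed

lemma disc_lift_subset: "disc_lift \<subseteq> {z. fst z \<noteq> 0}"
  by (auto simp: disc_lift_def)

lemma lift_rad_props:
  assumes "z \<in> disc_lift"
  shows "lift_rad z > 0" "(lift_rad z)\<^sup>2 * (1 - (lift_rad z)\<^sup>2) = dsgn (fst z) (snd z) \<bullet> dsgn (fst z) (snd z)"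
    "2 * (lift_rad z)\<^sup>2 > 1"
  using assms rad_props[of "dsgn (fst z) (snd z) \<bullet> dsgn (fst z) (snd z)"]
  unfolding lift_rad_def disc_lift_def by auto (smt (verit) real_sqrt_gt_zero)

lemma smooth_on_lift_rad: "smooth_on disc_lift (lift_rad :: 'a::euclidean_space \<times> 'a \<Rightarrow> real)"
proof -
  have "smooth_on disc_lift (\<lambda>z :: 'a \<times> 'a. sqrt ((1 + sqrt (1 - 4 * (dsgn (fst z) (snd z) \<bullet> dsgn (fst z) (snd z)))) / 2))"
    by (intro smooth_on_sqrt smooth_on_divide smooth_on_add smooth_on_diff smooth_on_mult smooth_on_const
        smooth_on_inner smooth_on_subset[OF smooth_on_dsgn disc_lift_subset] open_disc_lift)
      (auto simp: disc_lift_def add_pos_pos)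
  then show ?thesis by (simp add: lift_rad_def[abs_def] rad_def)
qed

lemma smooth_on_polar_lift: "smooth_on disc_lift (polar_lift :: (real ^ 'm) \<times> (real ^ 'm) \<Rightarrow> complex ^ 'm::finite)"
proof -
  have "smooth_on disc_lift (\<lambda>z :: (real ^ 'm) \<times> (real ^ 'm). (lift_rad z *\<^sub>R sgn (fst z), - (inverse (lift_rad z) *\<^sub>R dsgn (fst z) (snd z))))"
    by (intro smooth_on_Pair smooth_on_scaleR smooth_on_minus smooth_on_inverse open_disc_lift
        smooth_on_subset[OF smooth_on_dsgn disc_lift_subset] smooth_on_subset[OF smooth_on_sgn_fst disc_lift_subset]
        smooth_on_lift_rad) (use lift_rad_props(1) in fastforce)
  from smooth_on_linear_compose[OF open_disc_lift bounded_linear_cplx this]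
  show ?thesis by (simp add: polar_lift_def[abs_def])
qed

lemma polar_parts:
  assumes "z \<in> disc_lift"
  shows "sgn (fst z) \<bullet> sgn (fst z) = 1" "dsgn (fst z) (snd z) \<bullet> sgn (fst z) = 0"
  using assms dsgn_orthogonal[of "fst z" "snd z"]
  by (auto simp: disc_lift_def sgn_div_norm dot_square_norm power2_eq_square)

lemma polar_lift_norms:
  assumes "z \<in> disc_lift"
  defines "a \<equiv> lift_rad z *\<^sub>R sgn (fst z)" and "b \<equiv> inverse (lift_rad z) *\<^sub>R dsgn (fst z) (snd z)"
  shows "a \<bullet> a = (lift_rad z)\<^sup>2" "b \<bullet> b = 1 - (lift_rad z)\<^sup>2" "a \<bullet> b = 0"
proof -
  note p = polar_parts[OF assms(1)] and r = lift_rad_props[OF assms(1)]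
  show "a \<bullet> a = (lift_rad z)\<^sup>2" using p by (simp add: a_def power2_eq_square)
  show "a \<bullet> b = 0" using p by (simp add: a_def b_def inner_commute)
  have "b \<bullet> b = inverse (lift_rad z) * inverse (lift_rad z) * ((lift_rad z)\<^sup>2 * (1 - (lift_rad z)\<^sup>2))"
    unfolding r(2) by (simp add: b_def)
  also have "\<dots> = (inverse (lift_rad z) * lift_rad z)\<^sup>2 * (1 - (lift_rad z)\<^sup>2)"
    by (simp add: power2_eq_square algebra_simps)
  finally show "b \<bullet> b = 1 - (lift_rad z)\<^sup>2" using r(1) by simp
qed

lemma norm_polar_lift:
  assumes "z \<in> disc_lift"
  shows "norm (polar_lift z) = 1"
proof -
  have "(norm (polar_lift z))\<^sup>2 = 1"
    unfolding polar_lift_def norm_cplx inner_minus_left inner_minus_right polar_lift_norms[OF assms] by simp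
  then show ?thesis by (metis norm_ge_zero power2_eq_iff_nonneg one_power2 zero_le_one)
qed

lemma polar_lift_nonzero: "z \<in> disc_lift \<Longrightarrow> polar_lift z \<noteq> 0"
  using norm_polar_lift by fastforce

lemma qform_polar_lift:
  assumes "z \<in> disc_lift"
  shows "qform (polar_lift z) = complex_of_real (2 * (lift_rad z)\<^sup>2 - 1)" "2 * (lift_rad z)\<^sup>2 - 1 > 0"
  using polar_lift_norms[OF assms] lift_rad_props(3)[OF assms]
  by (auto simp: polar_lift_def qform_cplx complex_eq_iff)

text \<open>On the unit sphere the Fubini--Study form is four times the standard symplectic form: vectors tangent to
  the sphere have purely imaginary Hermitian product with the base point, so the correction term in
  \<^const>\<open>fs_lift\<close> is real. With real part \<open>f s\<close> and imaginary part \<open>- h / f\<close>, the identity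
  \<open>polar_identity\<close> gives \<open>4 dh \<and> ds\<close>, where \<open>ds\<close> is \<^term>\<open>dsgn (fst z)\<close> on the first component.\<close>

lemma polar_lift_pullback:
  fixes z :: "(real ^ 'm::finite) \<times> (real ^ 'm)"
  assumes z: "z \<in> disc_lift"
  obtains h' D where
    "((\<lambda>z. dsgn (fst z) (snd z)) has_derivative h') (at z)"
    "(polar_lift has_derivative D) (at z)"
    "\<And>v w. fs_lift 4 (polar_lift z) (D v) (D w)
       = 4 * (h' v \<bullet> dsgn (fst z) (fst w) - h' w \<bullet> dsgn (fst z) (fst v))"
proof -
  let ?x = "fst z"
  let ?s = "\<lambda>z :: (real ^ 'm) \<times> (real ^ 'm). sgn (fst z)"
  let ?h = "\<lambda>z :: (real ^ 'm) \<times> (real ^ 'm). dsgn (fst z) (snd z)"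
  let ?f = "lift_rad :: (real ^ 'm) \<times> (real ^ 'm) \<Rightarrow> real"
  have x: "?x \<noteq> 0" using z by (simp add: disc_lift_def)
  have f: "?f z \<noteq> 0" using lift_rad_props(1)[OF z] by simp
  obtain h' where h': "(?h has_derivative h') (at z)"
    using smooth_on_has_derivative[OF smooth_on_dsgn open_fst_nonzero] x by blast
  obtain f' where f': "(?f has_derivative f') (at z)"
    using smooth_on_has_derivative[OF smooth_on_lift_rad open_disc_lift z] by blast
  let ?s' = "\<lambda>v. dsgn ?x (fst v)"
  have s': "(?s has_derivative ?s') (at z)"
    by (rule has_derivative_compose[where f = fst and g = sgn, OF _ sgn_has_derivative[OF x]])
       (simp add: bounded_linear_imp_has_derivative bounded_linear_fst)
  define A where "A = (\<lambda>z. ?f z *\<^sub>R ?s z)"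
  define B where "B = (\<lambda>z. inverse (?f z) *\<^sub>R ?h z)"
  define a where "a = (\<lambda>v. ?f z *\<^sub>R ?s' v + f' v *\<^sub>R ?s z)"
  define b where "b = (\<lambda>v. inverse (?f z) *\<^sub>R h' v - (f' v * inverse (?f z) * inverse (?f z)) *\<^sub>R ?h z)"
  have A: "(A has_derivative a) (at z)"
    unfolding A_def a_def by (intro has_derivative_scaleR f' s')
  have "(B has_derivative (\<lambda>v. inverse (?f z) *\<^sub>R h' v + (- (inverse (?f z) * f' v * inverse (?f z))) *\<^sub>R ?h z)) (at z)"
    unfolding B_def by (intro has_derivative_scaleR h' Deriv.has_derivative_inverse[OF f f'])
  then have B: "(B has_derivative b) (at z)"
    by (simp add: b_def ac_simps)
  define D where "D = (\<lambda>v. cplx (a v) (- b v))"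
  have pl: "polar_lift = (\<lambda>z. cplx (A z) (- B z))"
    by (simp add: polar_lift_def[abs_def] A_def B_def)
  have D: "(polar_lift has_derivative D) (at z)"
    using bounded_linear.has_derivative[OF bounded_linear_cplx has_derivative_Pair[OF A has_derivative_minus[OF B]]]
    unfolding pl D_def by simp
  have orth: "h' v \<bullet> ?s z = - (?h z \<bullet> ?s' v)" for v
  proof -
    have 1: "((\<lambda>y. ?h y \<bullet> ?s y) has_derivative (\<lambda>v. ?h z \<bullet> ?s' v + h' v \<bullet> ?s z)) (at z)"
      by (rule has_derivative_inner[OF h' s'])
    have 2: "((\<lambda>y. ?h y \<bullet> ?s y) has_derivative (\<lambda>v. 0)) (at z)"
      by (rule has_derivative_transform_within_open[OF has_derivative_const open_disc_lift z])
        (simp add: polar_parts)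
    show ?thesis using fun_cong[OF has_derivative_unique[OF 1 2], of v] by simp
  qed
  \<comment> \<open>The derivative of \<open>\<bar>polar_lift z\<bar> = 1\<close>.\<close>
  have sphere: "a v \<bullet> A z + b v \<bullet> B z = 0" for v
  proof -
    have 1: "((\<lambda>y. A y \<bullet> A y + B y \<bullet> B y) has_derivative
        (\<lambda>v. (A z \<bullet> a v + a v \<bullet> A z) + (B z \<bullet> b v + b v \<bullet> B z))) (at z)"
      by (intro has_derivative_add has_derivative_inner A B)
    have "A y \<bullet> A y + B y \<bullet> B y = 1" if "y \<in> disc_lift" for y
      unfolding A_def B_def polar_lift_norms[OF that] by simp
    then have 2: "((\<lambda>y. A y \<bullet> A y + B y \<bullet> B y) has_derivative (\<lambda>v. 0)) (at z)"
      by (intro has_derivative_transform_within_open[OF has_derivative_const open_disc_lift z]) simp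
    show ?thesis using fun_cong[OF has_derivative_unique[OF 1 2], of v] by (simp add: inner_commute)
  qed
  have "fs_lift 4 (polar_lift z) (D v) (D w) = 4 * (h' v \<bullet> dsgn ?x (fst w) - h' w \<bullet> dsgn ?x (fst v))" for v w
  proof -
    have re: "Re (herm (D v) (polar_lift z)) = 0" "Re (herm (polar_lift z) (D w)) = 0"
      using sphere[of v] sphere[of w] by (simp_all add: pl D_def herm_cplx inner_commute)
    have n: "herm (polar_lift z) (polar_lift z) = 1"
      using norm_polar_lift[OF z] by (simp add: herm_self)
    have "fs_lift 4 (polar_lift z) (D v) (D w) = 4 * Im (herm (D v) (D w))"
      unfolding fs_lift_def n using re by (simp add: norm_polar_lift[OF z])
    also have "\<dots> = 4 * (b v \<bullet> a w - a v \<bullet> b w)"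
      by (simp add: D_def herm_cplx)
    also have "b v \<bullet> a w - a v \<bullet> b w = h' v \<bullet> ?s' w - h' w \<bullet> ?s' v"
      unfolding a_def b_def
      by (rule polar_identity[OF f polar_parts(2)[OF z] orth orth])
    finally show ?thesis .
  qed
  then show ?thesis using that h' D by blast
qed

section \<open>Dependence on the lift\<close>

text \<open>Another representative of the same tangent vector only changes the sign.\<close>

lemma dsgn_scale:
  fixes x :: "'a::real_inner"
  assumes "x \<noteq> 0" "c \<noteq> 0"
  shows "dsgn (c *\<^sub>R x) (c *\<^sub>R u + d *\<^sub>R x) = sgn c *\<^sub>R dsgn x u"
proof -
  define r a where "r = inverse (norm x)" and "a = inverse \<bar>c\<bar>"
  have r: "r ^ 3 * (x \<bullet> x) = r" using inverse_norm_power[OF assms(1)] by (simp add: r_def)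
  have a: "a\<^sup>2 * c\<^sup>2 = 1"
    using assms(2) by (simp add: a_def power_inverse)
  have s: "sgn c = a * c" by (simp add: a_def sgn_div_norm)
  have n: "inverse (norm (c *\<^sub>R x)) = a * r" by (simp add: a_def r_def)
  have "a * r * d - (a * r) ^ 3 * ((c * (u \<bullet> x) + d * (x \<bullet> x)) * c) * c
      = a * d * (r - (a\<^sup>2 * c\<^sup>2) * (r ^ 3 * (x \<bullet> x))) - (a\<^sup>2 * c\<^sup>2) * (a * c) * r ^ 3 * (u \<bullet> x)"
    by algebra
  then have k: "a * r * d - (a * r) ^ 3 * ((c * (u \<bullet> x) + d * (x \<bullet> x)) * c) * c = - (a * c * (r ^ 3 * (u \<bullet> x)))"
    by (simp add: a r)
  have "dsgn (c *\<^sub>R x) (c *\<^sub>R u + d *\<^sub>R x)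
      = (a * c * r) *\<^sub>R u + (a * r * d - (a * r) ^ 3 * ((c * (u \<bullet> x) + d * (x \<bullet> x)) * c) * c) *\<^sub>R x"
    unfolding dsgn_def n by (simp add: inner_add_left algebra_simps)
  also have "\<dots> = sgn c *\<^sub>R dsgn x u"
    unfolding k by (simp add: dsgn_def r_def[symmetric] s algebra_simps)
  finally show ?thesis .
qed

lemma polar_lift_scale:
  assumes "fst z \<noteq> 0" "c \<noteq> 0"
  shows "polar_lift (c *\<^sub>R fst z, c *\<^sub>R snd z + d *\<^sub>R fst z) = complex_of_real (sgn c) *s polar_lift z"
proof -
  have "sgn c * sgn c = 1" using assms(2) by (simp add: sgn_if)
  then have "sgn c * (sgn c * t) = t" for t by (metis mult.assoc mult_1)
  then show ?thesis
    by (simp add: polar_lift_def lift_rad_def dsgn_scale[OF assms] cplx_scale sgn_scaleR ac_simps)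
qed

section \<open>The unit disc bundle of real projective space\<close>

definition tangent_pr :: "(real ^ 'n::finite option) \<times> (real ^ 'n option) \<Rightarrow> (real ^ 'n option) set \<times> ('n option \<Rightarrow> real ^ 'n)" where
  "tangent_pr z = (line (fst z), lpush (fst z) (snd z))"

definition tangent_lch :: "'n::finite option \<Rightarrow> (real ^ 'n option) \<times> (real ^ 'n option) \<Rightarrow> (real ^ 'n) \<times> (real ^ 'n)" where
  "tangent_lch i z = (hom_chart i (fst z), frechet_derivative (hom_chart i) (at (fst z)) (snd z))"

definition tangent_sec :: "'n::finite option \<Rightarrow> (real ^ 'n) \<times> (real ^ 'n) \<Rightarrow> (real ^ 'n option) \<times> (real ^ 'n option)" where
  "tangent_sec i y = (insert_coord 1 i (fst y), insert_coord 0 i (snd y))"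

lemma TRP_cover: "smooth_cover (tangent_bundle RP) ((- {0}) \<times> UNIV) tangent_pr tangent_lch tangent_sec"
  using smooth_cover.tangent_bundle_cover[OF proj_cover]
  unfolding tangent_pr_def[abs_def] tangent_lch_def[abs_def] tangent_sec_def[abs_def] frechet_derivative_insert_coord .

abbreviation disc_RP :: "((real ^ 'n option) set \<times> ('n::finite option \<Rightarrow> real ^ 'n), 'n option, (real ^ 'n) \<times> (real ^ 'n)) mfd" where
  "disc_RP \<equiv> unit_disc_bundle RP (RP_metric 4)"

lemma RP_metric_dsgn:
  assumes "x \<noteq> 0"
  shows "RP_metric 4 (line x) (lpush x u) (lpush x w) = 4 * (dsgn x u \<bullet> dsgn x w)"
  by (simp add: RP_metric_line[OF assms] dsgn_inner_dsgn[OF assms])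

text \<open>The norm of a tangent vector is twice the length of \<^const>\<open>dsgn\<close>, which makes \<^const>\<open>disc_lift\<close> the preimage
  of the unit disc bundle.\<close>

lemma disc_lift_eq:
  "{z \<in> (- {0}) \<times> UNIV. tangent_pr z \<in> {(x, v). RP_metric 4 x v v < 1}} = disc_lift"
  by (auto simp: disc_lift_def tangent_pr_def RP_metric_dsgn)

lemma disc_RP_cover: "smooth_cover disc_RP disc_lift tangent_pr tangent_lch tangent_sec"
  using smooth_cover.restrict_cover[OF TRP_cover, of "{(x, v). RP_metric 4 x v v < 1}"] open_disc_lift
  unfolding disc_lift_eq unit_disc_bundle_def by blast

abbreviation dpush :: "(real ^ 'n::finite option) \<times> (real ^ 'n option) \<Rightarrow> (real ^ 'n option) \<times> (real ^ 'n option) \<Rightarrow>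
  ('n option \<Rightarrow> (real ^ 'n) \<times> (real ^ 'n))" where
  "dpush \<equiv> push disc_RP tangent_pr tangent_lch"

text \<open>In the notation of the introduction, the canonical 1-form is \<open>4 h \<cdot> ds\<close>.\<close>

lemma canonical_one_form_lift:
  fixes z :: "(real ^ 'n::finite option) \<times> (real ^ 'n option)"
  assumes "z \<in> disc_lift"
  shows "canonical_one_form RP (RP_metric 4) (tangent_pr z) (dpush z \<zeta>)
    = 4 * (dsgn (fst z) (snd z) \<bullet> dsgn (fst z) (fst \<zeta>))"
proof -
  have x: "fst z \<noteq> 0" using assms by (simp add: disc_lift_def)
  have "tangent_pr z \<in> {(x, v). RP_metric 4 x v v < 1}"
    using assms unfolding disc_lift_eq[symmetric] by simp
  then have "dpush z \<zeta> = push (tangent_bundle RP) tangent_pr tangent_lch z \<zeta>"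
    unfolding unit_disc_bundle_def by (rule smooth_cover.push_restrict[OF TRP_cover])
  moreover have "differential (tangent_bundle RP) RP fst (tangent_pr z) (push (tangent_bundle RP) tangent_pr tangent_lch z \<zeta>)
      = lpush (fst z) (fst \<zeta>)"
  proof (rule differential_push_global[OF TRP_cover proj_cover])
    have "open ((- {0 :: real ^ 'n option}) \<times> (UNIV :: (real ^ 'n option) set))" by (intro open_Times) auto
    then show "smooth_on ((- {0 :: real ^ 'n option}) \<times> (UNIV :: (real ^ 'n option) set)) fst"
      by (intro smooth_on_linear bounded_linear_fst)
    show "z \<in> (- {0}) \<times> UNIV" using x by (cases z) auto
  qed (auto simp: tangent_pr_def bounded_linear_imp_has_derivative bounded_linear_fst)
  ultimately show ?thesis
    by (simp add: canonical_one_form_def tangent_pr_def RP_metric_dsgn[OF x])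
qed

text \<open>The exterior derivative of \<open>4 h \<cdot> ds\<close> is \<open>4 dh \<and> ds\<close>. The representatives are taken at the point chosen by
  the section of the chart at y, where the affine form of the section applies.\<close>

lemma ext_deriv_canonical:
  fixes y :: "(real ^ 'n::finite option) set \<times> ('n option \<Rightarrow> real ^ 'n)"
  assumes y: "y \<in> points disc_RP" and v: "v \<in> tangent_space disc_RP y" and w: "w \<in> tangent_space disc_RP y"
  obtains z \<xi> \<eta> where "z \<in> disc_lift" "y = tangent_pr z" "v = dpush z \<xi>" "w = dpush z \<eta>"
    "\<And>h'. ((\<lambda>z. dsgn (fst z) (snd z)) has_derivative h') (at z) \<Longrightarrow>
       ext_deriv disc_RP (canonical_one_form RP (RP_metric 4)) y v w
       = 4 * (h' \<xi> \<bullet> dsgn (fst z) (fst \<eta>) - h' \<eta> \<bullet> dsgn (fst z) (fst \<xi>))"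
proof -
  interpret D: smooth_cover disc_RP disc_lift tangent_pr tangent_lch "tangent_sec :: 'n option \<Rightarrow> _"
    by (rule disc_RP_cover)
  define i where "i = chart_at disc_RP y"
  have yi: "y \<in> chart_dom disc_RP i" unfolding i_def by (rule chart_at_in[OF y])
  define z where "z = tangent_sec i (chart disc_RP i y)"
  have z: "z \<in> disc_lift" "tangent_pr z = y"
    using D.sec_in[OF yi] D.pr_sec[OF yi] by (auto simp: z_def)
  then have x: "fst z \<noteq> 0" by (auto simp: disc_lift_def)
  define L :: "(real ^ 'n) \<times> (real ^ 'n) \<Rightarrow> (real ^ 'n option) \<times> (real ^ 'n option)"
    where "L = (\<lambda>c. (insert_coord 0 i (fst c), insert_coord 0 i (snd c)))"
  have L: "frechet_derivative (tangent_sec i) (at a) = L" for a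
  proof -
    have "(tangent_sec i has_derivative L) (at a)"
      unfolding tangent_sec_def[abs_def] L_def
      by (intro has_derivative_Pair has_derivative_compose[OF _ insert_coord_has_derivative]
          bounded_linear_imp_has_derivative bounded_linear_fst bounded_linear_snd)
    then show ?thesis by (rule frechet_derivative_at[symmetric])
  qed
  note vw = D.tangent_eq_push[OF v yi, folded z_def, unfolded L] D.tangent_eq_push[OF w yi, folded z_def, unfolded L]
  obtain S where S: "\<And>u. ((\<lambda>x. dsgn x u) has_derivative S u) (at (fst z))" "\<And>u w. S u w = S w u"
    by (rule dsgn_has_derivative_symmetric[OF x]) blast
  have "ext_deriv disc_RP (canonical_one_form RP (RP_metric 4)) y v w
       = 4 * (h' (L (v i)) \<bullet> dsgn (fst z) (fst (L (w i))) - h' (L (w i)) \<bullet> dsgn (fst z) (fst (L (v i))))"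
    if h': "((\<lambda>z. dsgn (fst z) (snd z)) has_derivative h') (at z)" for h'
  proof -
    \<comment> \<open>The derivative of \<open>4 h \<bullet> ds(\<zeta>)\<close> along v; S is the second derivative of \<^const>\<open>sgn\<close>.\<close>
    let ?D = "\<lambda>\<zeta> v. 4 * (dsgn (fst z) (snd z) \<bullet> S (fst \<zeta>) (fst v) + h' v \<bullet> dsgn (fst z) (fst \<zeta>))"
    have "((\<lambda>z. canonical_one_form RP (RP_metric 4) (tangent_pr z) (dpush z \<zeta>)) has_derivative ?D \<zeta>) (at z)" for \<zeta>
    proof -
      have "((\<lambda>z. dsgn (fst z) (fst \<zeta>)) has_derivative (\<lambda>v. S (fst \<zeta>) (fst v))) (at z)"
        by (rule has_derivative_compose[where f = fst, OF _ S(1)])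
           (simp add: bounded_linear_imp_has_derivative bounded_linear_fst)
      from has_derivative_mult_right[OF has_derivative_inner[OF h' this], of 4]
      show ?thesis
        by (rule has_derivative_transform_within_open[OF _ open_disc_lift z(1)])
           (simp add: canonical_one_form_lift)
    qed
    then have "ext_deriv disc_RP (canonical_one_form RP (RP_metric 4)) y v w = ?D (L (w i)) (L (v i)) - ?D (L (v i)) (L (w i))"
      by (intro D.ext_deriv_affine_section[OF yi i_def L]) (simp add: z_def)
    then show ?thesis using S(2) by (simp add: algebra_simps)
  qed
  then show ?thesis using that[OF z(1) z(2)[symmetric] vw] by blast
qed

section \<open>The symplectomorphism\<close>

lemma smooth_on_qform: "smooth_on UNIV (qform :: complex ^ 'm::finite \<Rightarrow> complex)"
  unfolding qform_def[abs_def] power2_eq_square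
  by (intro smooth_on_sum smooth_on_mult smooth_on_vec_nth smooth_on_ident open_UNIV)

lemma open_qform_nonzero: "open {z :: complex ^ 'm::finite. qform z \<noteq> 0}"
  by (intro open_Collect_neq smooth_on_imp_continuous_on[OF smooth_on_qform] continuous_on_const)

lemma quadric_complement_eq: "{z \<in> - {0}. line z \<in> - quadric} = {z :: complex ^ 'n::finite option. qform z \<noteq> 0}"
proof -
  have "z \<in> - {0} \<and> line z \<in> - quadric \<longleftrightarrow> qform z \<noteq> 0" for z :: "complex ^ 'n option"
    by (cases "z = 0") (simp_all add: line_in_quadric_iff, simp add: qform_def)
  then show ?thesis by blast
qed

abbreviation CQ :: "((complex ^ 'n option) set, 'n::finite option, complex ^ 'n) mfd" where
  "CQ \<equiv> restrict_mfd CP (- quadric)"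

lemma CQ_cover:
  "smooth_cover (CQ :: ((complex ^ 'n option) set, 'n::finite option, complex ^ 'n) mfd)
     {z. qform z \<noteq> 0} line hom_chart (insert_coord 1)"
  using smooth_cover.restrict_cover[OF proj_cover, of "- quadric :: (complex ^ 'n option) set set"]
  unfolding quadric_complement_eq using open_qform_nonzero by blast

lemma push_CQ:
  fixes z :: "complex ^ 'n::finite option"
  assumes "qform z \<noteq> 0"
  shows "push CQ line hom_chart z u = lpush z u"
proof -
  have "z \<in> {z \<in> - {0}. line z \<in> - quadric}" using assms unfolding quadric_complement_eq by simp
  then show ?thesis by (intro smooth_cover.push_restrict[OF proj_cover]) simp
qed

text \<open>Defined through an arbitrary lift; \<open>disc_map_tangent_pr\<close> shows that the line does not depend on the lift.\<close>

definition disc_map :: "(real ^ 'n::finite option) set \<times> ('n option \<Rightarrow> real ^ 'n) \<Rightarrow> (complex ^ 'n option) set" where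
  "disc_map y = (THE p. \<exists>z. fst z \<noteq> 0 \<and> y = tangent_pr z \<and> p = line (polar_lift z))"

lemma tangent_pr_eqE:
  assumes "fst z \<noteq> 0" "fst z' \<noteq> 0" "tangent_pr z = tangent_pr z'"
  obtains c d where "c \<noteq> 0" "z' = (c *\<^sub>R fst z, c *\<^sub>R snd z + d *\<^sub>R fst z)"
proof -
  have e: "line (fst z) = line (fst z')" "lpush (fst z) (snd z) = lpush (fst z') (snd z')"
    using assms(3) by (auto simp: tangent_pr_def)
  obtain c where c: "c \<noteq> 0" "fst z' = c *s fst z"
      "\<And>u u'. lpush (fst z) u = lpush (fst z') u' \<Longrightarrow> \<exists>d. u' = c *s u + d *s fst z"
    by (rule lpush_lift_unique[OF assms(1,2) e(1)]) blast
  from c(3)[OF e(2)] obtain d where "snd z' = c *s snd z + d *s fst z" by blast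
  then have "z' = (c *\<^sub>R fst z, c *\<^sub>R snd z + d *\<^sub>R fst z)"
    using c(2) by (simp add: prod_eq_iff scalar_mult_eq_scaleR)
  with c(1) show ?thesis by (rule that)
qed

text \<open>Conversely to \<open>tangent_pr_eqE\<close>, all these lifts represent the same tangent vector.\<close>

lemma tangent_pr_scale:
  assumes "fst z \<noteq> 0" "c \<noteq> 0"
  shows "tangent_pr (c *\<^sub>R fst z, c *\<^sub>R snd z + d *\<^sub>R fst z) = tangent_pr z"
proof -
  have "lpush (c *\<^sub>R fst z) (c *\<^sub>R snd z + d *\<^sub>R fst z) = lpush (c *s fst z) (c *s (snd z + (d / c) *s fst z))"
    using assms(2) by (simp add: scalar_mult_eq_scaleR scaleR_add_right)
  also have "\<dots> = lpush (fst z) (snd z + (d / c) *s fst z)"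
    by (rule lpush_scale[OF assms])
  also have "\<dots> = lpush (fst z) (snd z)"
    using lpush_eq_iff[OF assms(1), of "snd z"] by metis
  finally show ?thesis
    using line_scale[OF assms(2), of "fst z"] by (simp add: tangent_pr_def scalar_mult_eq_scaleR)
qed

lemma disc_map_tangent_pr:
  assumes "fst z \<noteq> 0"
  shows "disc_map (tangent_pr z) = line (polar_lift z)"
  unfolding disc_map_def
proof (rule the_equality)
  show "\<exists>z'. fst z' \<noteq> 0 \<and> tangent_pr z = tangent_pr z' \<and> line (polar_lift z) = line (polar_lift z')"
    using assms by blast
  fix p assume "\<exists>z'. fst z' \<noteq> 0 \<and> tangent_pr z = tangent_pr z' \<and> p = line (polar_lift z')"
  then obtain z' where z': "fst z' \<noteq> 0" "tangent_pr z = tangent_pr z'" "p = line (polar_lift z')" by blast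
  obtain c d where c: "c \<noteq> 0" "z' = (c *\<^sub>R fst z, c *\<^sub>R snd z + d *\<^sub>R fst z)"
    by (rule tangent_pr_eqE[OF assms z'(1,2)])
  have "complex_of_real (sgn c) \<noteq> 0" using c(1) by (simp add: sgn_if)
  then show "p = line (polar_lift z)"
    unfolding z'(3) c(2) polar_lift_scale[OF assms c(1)] by (rule line_scale)
qed

lemma disc_map_lift:
  assumes "z \<in> disc_lift"
  shows "qform (polar_lift z) \<noteq> 0" "disc_map (tangent_pr z) = line (polar_lift z)"
proof -
  show "disc_map (tangent_pr z) = line (polar_lift z)"
    using assms by (intro disc_map_tangent_pr) (simp add: disc_lift_def)
  show "qform (polar_lift z) \<noteq> 0"
    unfolding qform_polar_lift(1)[OF assms] using qform_polar_lift(2)[OF assms]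
    by (simp only: of_real_eq_0_iff)
qed

lemma smooth_map_disc_map: "smooth_map disc_RP CQ disc_map"
  by (rule smooth_map_globalI[OF disc_RP_cover CQ_cover smooth_on_polar_lift]) (auto simp: disc_map_lift)

lemma disc_map_symplectic:
  assumes "y \<in> points disc_RP" "v \<in> tangent_space disc_RP y" "w \<in> tangent_space disc_RP y"
  shows "fs_form 4 (disc_map y) (differential disc_RP CQ disc_map y v) (differential disc_RP CQ disc_map y w)
    = ext_deriv disc_RP (canonical_one_form RP (RP_metric 4)) y v w"
proof -
  obtain z \<xi> \<eta> where z: "z \<in> disc_lift" "y = tangent_pr z" "v = dpush z \<xi>" "w = dpush z \<eta>"
    and ext: "\<And>h'. ((\<lambda>z. dsgn (fst z) (snd z)) has_derivative h') (at z) \<Longrightarrow>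
       ext_deriv disc_RP (canonical_one_form RP (RP_metric 4)) y v w
       = 4 * (h' \<xi> \<bullet> dsgn (fst z) (fst \<eta>) - h' \<eta> \<bullet> dsgn (fst z) (fst \<xi>))"
    by (rule ext_deriv_canonical[OF assms]) blast
  obtain h' D where h': "((\<lambda>z. dsgn (fst z) (snd z)) has_derivative h') (at z)"
    and D: "(polar_lift has_derivative D) (at z)"
    and pb: "\<And>v w. fs_lift 4 (polar_lift z) (D v) (D w)
       = 4 * (h' v \<bullet> dsgn (fst z) (fst w) - h' w \<bullet> dsgn (fst z) (fst v))"
    by (rule polar_lift_pullback[OF z(1)]) blast
  have q: "qform (polar_lift z) \<noteq> 0" by (rule disc_map_lift[OF z(1)])
  have "differential disc_RP CQ disc_map (tangent_pr z) (dpush z \<zeta>) = lpush (polar_lift z) (D \<zeta>)" for \<zeta>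
    unfolding push_CQ[OF q, symmetric]
    by (rule differential_push_global[OF disc_RP_cover CQ_cover smooth_on_polar_lift _ _ z(1) D])
       (auto simp: disc_map_lift)
  then show ?thesis
    unfolding ext[OF h'] unfolding z(2-4) disc_map_lift(2)[OF z(1)]
    by (simp add: fs_form_line[OF polar_lift_nonzero[OF z(1)]] pb)
qed

text \<open>If two lifts \<open>polar_lift z\<close> and \<open>polar_lift z'\<close> span the same line, then their ratio c has modulus 1, both
  being unit vectors, and \<open>c\<^sup>2\<close> is a positive real number, as \<^const>\<open>qform\<close> is positive on both. Hence
  \<open>c = \<plusminus>1\<close>, and the real and imaginary parts determine the tangent vector.\<close>

lemma inj_on_disc_map: "inj_on disc_map (points disc_RP)"
proof (rule inj_onI)
  fix y y' :: "(real ^ 'n::finite option) set \<times> ('n option \<Rightarrow> real ^ 'n)"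
  assume y: "y \<in> points disc_RP" "y' \<in> points disc_RP" and eq: "disc_map y = disc_map y'"
  have im: "points disc_RP = tangent_pr ` (disc_lift :: ((real ^ 'n option) \<times> (real ^ 'n option)) set)"
    using smooth_cover.pr_image[OF disc_RP_cover] by metis
  obtain z z' where z: "z \<in> disc_lift" "y = tangent_pr z" and z': "z' \<in> disc_lift" "y' = tangent_pr z'"
    using y unfolding im by blast
  have "line (polar_lift z) = line (polar_lift z')"
    using eq by (simp add: z z' disc_map_lift)
  then obtain c where c: "polar_lift z' = c *s polar_lift z"
    using line_eq_iff[OF polar_lift_nonzero[OF z(1)]] by blast
  have "complex_of_real (2 * (lift_rad z')\<^sup>2 - 1) = c\<^sup>2 * complex_of_real (2 * (lift_rad z)\<^sup>2 - 1)"
    by (simp only: qform_polar_lift(1)[OF z(1), symmetric] qform_polar_lift(1)[OF z'(1), symmetric] c qform_scale)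
  then have "c\<^sup>2 = complex_of_real ((2 * (lift_rad z')\<^sup>2 - 1) / (2 * (lift_rad z)\<^sup>2 - 1))"
    using qform_polar_lift(2)[OF z(1)] unfolding of_real_divide
    by (metis less_irrefl nonzero_eq_divide_eq of_real_eq_0_iff)
  moreover have "(2 * (lift_rad z')\<^sup>2 - 1) / (2 * (lift_rad z)\<^sup>2 - 1) > 0"
    using qform_polar_lift(2)[OF z(1)] qform_polar_lift(2)[OF z'(1)] by simp
  ultimately have "Im (c\<^sup>2) = 0" "Re (c\<^sup>2) > 0" by simp_all
  then have "Re c = 0 \<or> Im c = 0" "Im c * Im c < Re c * Re c" by (auto simp: power2_eq_square)
  then have Im0: "Im c = 0" by (metis mult_zero_left not_square_less_zero)
  have "norm (c *s polar_lift z) ^ 4 = 1"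
    using norm_polar_lift[OF z'(1)] by (simp add: c)
  then have "(cmod c) ^ 4 = 1" using norm_polar_lift[OF z(1)] by (simp add: norm_scale4)
  then have "cmod c = 1" by (metis norm_ge_zero power_eq_1_iff zero_neq_numeral abs_of_nonneg real_norm_def)
  define r where "r = Re c"
  have r: "c = complex_of_real r" "\<bar>r\<bar> = 1"
    using Im0 \<open>cmod c = 1\<close> by (simp_all add: r_def complex_eq_iff cmod_def)
  have pl: "cplx (lift_rad z' *\<^sub>R sgn (fst z')) (- (inverse (lift_rad z') *\<^sub>R dsgn (fst z') (snd z')))
      = cplx (r *\<^sub>R (lift_rad z *\<^sub>R sgn (fst z))) (r *\<^sub>R (- (inverse (lift_rad z) *\<^sub>R dsgn (fst z) (snd z))))"
    using c by (simp only: polar_lift_def r(1) cplx_scale)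
  have x: "fst z \<noteq> 0" "fst z' \<noteq> 0" using z z' by (auto simp: disc_lift_def)
  have pos: "lift_rad z > 0" "lift_rad z' > 0" using lift_rad_props(1)[OF z(1)] lift_rad_props(1)[OF z'(1)] by simp_all
  have s: "lift_rad z' *\<^sub>R sgn (fst z') = (r * lift_rad z) *\<^sub>R sgn (fst z)"
    using pl by (simp add: cplx_inject)
  have h: "inverse (lift_rad z') *\<^sub>R dsgn (fst z') (snd z') = (r * inverse (lift_rad z)) *\<^sub>R dsgn (fst z) (snd z)"
    using pl by (simp add: cplx_inject)
  have "norm (lift_rad z' *\<^sub>R sgn (fst z')) = norm ((r * lift_rad z) *\<^sub>R sgn (fst z))" using s by simp
  then have f: "lift_rad z' = lift_rad z" using pos x r(2) by (simp add: norm_sgn abs_mult)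
  have s: "sgn (fst z') = r *\<^sub>R sgn (fst z)"
  proof -
    have "lift_rad z *\<^sub>R sgn (fst z') = lift_rad z *\<^sub>R (r *\<^sub>R sgn (fst z))" using s f by (simp add: mult.commute)
    then show ?thesis using pos by (simp only: scaleR_cancel_left) simp
  qed
  have h: "dsgn (fst z') (snd z') = r *\<^sub>R dsgn (fst z) (snd z)"
  proof -
    have "inverse (lift_rad z) *\<^sub>R dsgn (fst z') (snd z') = inverse (lift_rad z) *\<^sub>R (r *\<^sub>R dsgn (fst z) (snd z))"
      using h f by (simp add: mult.commute)
    then show ?thesis using pos by (simp only: scaleR_cancel_left) simp
  qed
  \<comment> \<open>The lift by a unit vector and an orthogonal representative.\<close>
  have norm_form: "tangent_pr (sgn (fst z), dsgn (fst z) (snd z)) = tangent_pr z" if "fst z \<noteq> 0"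
    for z :: "(real ^ 'n option) \<times> (real ^ 'n option)"
    using tangent_pr_scale[OF that, of "inverse (norm (fst z))" "- ((inverse (norm (fst z))) ^ 3 * (snd z \<bullet> fst z))"] that
    by (simp add: dsgn_def sgn_div_norm)
  have "y' = tangent_pr (r *\<^sub>R sgn (fst z), r *\<^sub>R dsgn (fst z) (snd z))"
    using norm_form[OF x(2)] s h z'(2) by simp
  also have "\<dots> = tangent_pr (sgn (fst z), dsgn (fst z) (snd z))"
    using tangent_pr_scale[of "(sgn (fst z), dsgn (fst z) (snd z))" r 0] x r by (auto simp: sgn_zero_iff)
  also have "\<dots> = y" using norm_form[OF x(1)] z(2) by simp
  finally show "y = y'" by simp
qed

section \<open>The inverse map\<close>

text \<open>A scalar w such that w z has positive \<^const>\<open>qform\<close>, wherever it does not vanish. If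
  \<open>e\<^sup>2 = cnj (qform z) / \<bar>qform z\<bar>\<close>, then e has modulus 1 and e z has positive \<^const>\<open>qform\<close>; here w is
  twice the real part of \<open>e z\<^sub>i\<close>, times e. Unlike e, it is a smooth function of z without a choice of
  the square root.\<close>

definition unphase :: "'m::finite \<Rightarrow> complex ^ 'm \<Rightarrow> complex" where
  "unphase i z = cnj (z $ i) + cnj (qform z) / complex_of_real (cmod (qform z)) * z $ i"

definition real_phase :: "'m::finite \<Rightarrow> complex ^ 'm \<Rightarrow> complex ^ 'm" where
  "real_phase i z = unphase i z *s z"

text \<open>For orthogonal x and y with x the longer one, the vector \<open>x + \<i> y\<close> is a positive multiple of
  \<open>f s - \<i> h / f\<close> with \<open>s = x / \<bar>x\<bar>\<close>, \<open>f = \<bar>x\<bar> / \<bar>x + \<i> y\<bar>\<close> and \<open>h = - \<bar>x\<bar> y / \<bar>x + \<i> y\<bar>\<^sup>2\<close>. The second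
  component is \<open>\<bar>x\<bar> h\<close>, the representative at x that is orthogonal to x.\<close>

definition inverse_lift :: "'m::finite \<Rightarrow> complex ^ 'm \<Rightarrow> (real ^ 'm) \<times> (real ^ 'm)" where
  "inverse_lift i z =
    (let x = (\<chi> j. Re (real_phase i z $ j)); y = (\<chi> j. Im (real_phase i z $ j))
     in (x, - ((x \<bullet> x) / (x \<bullet> x + y \<bullet> y)) *\<^sub>R y))"

lemma qform_real_phase:
  assumes "qform z \<noteq> 0" 
  shows "qform (real_phase i z) = complex_of_real ((cmod (unphase i z))\<^sup>2 * cmod (qform z))"
proof -
  let ?m = "qform z" and ?w = "unphase i z"
  define e where "e = cnj ?m / complex_of_real (cmod ?m)"
  have m: "complex_of_real (cmod ?m) \<noteq> 0" using assms by simp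
  have mm: "?m * cnj ?m = complex_of_real (cmod ?m) * complex_of_real (cmod ?m)"
    by (simp add: complex_norm_square[symmetric] power2_eq_square flip: of_real_mult)
  have em: "e * ?m = complex_of_real (cmod ?m)"
    using m mm by (simp add: e_def field_simps)
  have ee: "e * cnj e = 1"
    using m mm by (simp add: e_def field_simps)
  have w: "?w = cnj (z $ i) + e * z $ i" by (simp add: unphase_def e_def)
  \<comment> \<open>So \<open>w\<^sup>2 = e w cnj w\<close>, and the phase of \<open>w\<^sup>2\<close> cancels that of the quadratic form.\<close>
  have "?w = e * cnj ?w"
  proof -
    have "e * cnj ?w = e * z $ i + (e * cnj e) * cnj (z $ i)" unfolding w by (simp add: algebra_simps)
    then show ?thesis unfolding ee w by simp
  qed
  then have "qform (real_phase i z) = (?w * cnj ?w) * (e * ?m)"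
    unfolding real_phase_def qform_scale power2_eq_square by (metis mult.assoc mult.commute)
  then show ?thesis unfolding em by (simp add: complex_norm_square del: of_real_power)
qed

text \<open>If all the scalars vanish, then \<open>cnj z\<^sub>i = - e z\<^sub>i\<close> for all i, where \<open>e = cnj (qform z) / \<bar>qform z\<bar>\<close>, and
  multiplying by \<open>z\<^sub>i\<close> and summing gives \<open>\<bar>z\<bar>\<^sup>2 = - \<bar>qform z\<bar>\<close>.\<close>

lemma unphase_nonzero:
  assumes "qform z \<noteq> 0"
  obtains i where "unphase i z \<noteq> 0"
proof -
  have False if 0: "\<And>i. unphase i z = 0"
  proof -
    let ?m = "qform z"
    define e where "e = cnj ?m / complex_of_real (cmod ?m)"
    have "cnj (z $ i) = - e * z $ i" for i
      using 0[of i] by (simp add: unphase_def e_def add_eq_0_iff2)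
    then have "herm z z = (\<Sum>i\<in>UNIV. - e * (z $ i)\<^sup>2)"
      unfolding herm_def by (intro sum.cong) (auto simp: power2_eq_square)
    also have "\<dots> = - e * ?m" by (simp only: qform_def sum_distrib_left)
    also have "\<dots> = - complex_of_real (cmod ?m)"
    proof -
      have "?m * cnj ?m = complex_of_real (cmod ?m) * complex_of_real (cmod ?m)"
        by (simp add: complex_norm_square[symmetric] power2_eq_square flip: of_real_mult)
      then show ?thesis using assms by (simp add: e_def field_simps)
    qed
    finally have "complex_of_real ((norm z)\<^sup>2) = complex_of_real (- cmod ?m)" by (simp add: herm_self)
    then have "(norm z)\<^sup>2 = - cmod ?m" by (simp only: of_real_eq_iff)
    then show False using assms by (smt (verit) zero_le_power2 zero_less_norm_iff)
  qed
  then show ?thesis using that by blast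
qed

lemma inverse_quotient:
  fixes r t :: real
  assumes "S = t * t" "0 < t" "0 < r"
  shows "inverse (r / t) * (r / S) = inverse t"
  using assms by (simp add: field_simps)

lemma polar_lift_of_cplx:
  assumes o: "x \<bullet> y = 0" and l: "y \<bullet> y < x \<bullet> x"
  defines "z \<equiv> (x, - ((x \<bullet> x) / (x \<bullet> x + y \<bullet> y)) *\<^sub>R y)"
  shows "z \<in> disc_lift" "polar_lift z = complex_of_real (inverse (norm (cplx x y))) *s cplx x y"
proof -
  have x: "x \<noteq> 0" using l by (metis inner_ge_zero inner_zero_left not_le)
  define X Y where "X = x \<bullet> x" and "Y = y \<bullet> y"
  have XY: "0 \<le> Y" "Y < X" using l by (auto simp: X_def Y_def)
  have nx: "(norm x)\<^sup>2 = X" "norm x > 0" using x by (auto simp: X_def power2_norm_eq_inner)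
  have hz: "dsgn (fst z) (snd z) = (- (norm x / (X + Y))) *\<^sub>R y"
  proof -
    have "inverse (norm x) * (X / (X + Y)) = norm x / (X + Y)"
      using nx by (simp add: nx(1)[symmetric] power2_eq_square)
    then show ?thesis using o by (simp add: dsgn_def z_def X_def Y_def inner_commute)
  qed
  have q: "dsgn (fst z) (snd z) \<bullet> dsgn (fst z) (snd z) = X * Y / (X + Y)\<^sup>2"
  proof -
    have "dsgn (fst z) (snd z) \<bullet> dsgn (fst z) (snd z) = (norm x)\<^sup>2 * Y / (X + Y)\<^sup>2"
      unfolding hz by (simp add: Y_def power2_eq_square)
    then show ?thesis by (simp add: nx)
  qed
  have d: "1 - 4 * (X * Y / (X + Y)\<^sup>2) = ((X - Y) / (X + Y))\<^sup>2"
  proof -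
    have "1 - 4 * (X * Y / (X + Y)\<^sup>2) = ((X + Y)\<^sup>2 - 4 * (X * Y)) / (X + Y)\<^sup>2"
      using XY by (simp add: diff_divide_distrib)
    also have "(X + Y)\<^sup>2 - 4 * (X * Y) = (X - Y)\<^sup>2" by algebra
    finally show ?thesis by (simp add: power_divide)
  qed
  have "0 < ((X - Y) / (X + Y))\<^sup>2" using XY by simp
  then have "4 * (dsgn (fst z) (snd z) \<bullet> dsgn (fst z) (snd z)) < 1" unfolding q d[symmetric] by simp
  moreover have "fst z \<noteq> 0" using x by (simp add: z_def)
  ultimately show "z \<in> disc_lift" by (simp add: disc_lift_def)
  have n: "norm (cplx x y) = sqrt (X + Y)"
    using norm_cplx[of x y] by (simp add: X_def Y_def real_sqrt_unique)
  have f: "lift_rad z = norm x / sqrt (X + Y)"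
  proof -
    have "lift_rad z = sqrt ((1 + (X - Y) / (X + Y)) / 2)"
      using XY unfolding lift_rad_def rad_def q d by simp
    also have "(1 + (X - Y) / (X + Y)) / 2 = X / (X + Y)" using XY by (simp add: field_simps)
    also have "sqrt (X / (X + Y)) = norm x / sqrt (X + Y)"
      by (simp add: real_sqrt_divide X_def norm_eq_sqrt_inner)
    finally show ?thesis .
  qed
  have 1: "lift_rad z *\<^sub>R sgn (fst z) = inverse (sqrt (X + Y)) *\<^sub>R x"
  proof -
    have "fst z = x" by (simp add: z_def)
    then show ?thesis using nx by (simp add: f sgn_div_norm divide_inverse)
  qed
  have "inverse (lift_rad z) * (norm x / (X + Y)) = inverse (sqrt (X + Y))"
  proof -
    have "X + Y = sqrt (X + Y) * sqrt (X + Y)" "sqrt (X + Y) > 0" using XY by auto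
    then show ?thesis using nx(2) unfolding f by (intro inverse_quotient)
  qed
  then have 2: "- (inverse (lift_rad z) *\<^sub>R dsgn (fst z) (snd z)) = inverse (sqrt (X + Y)) *\<^sub>R y"
    by (simp add: hz)
  show "polar_lift z = complex_of_real (inverse (norm (cplx x y))) *s cplx x y"
    unfolding polar_lift_def 1 2 n cplx_scale ..
qed

lemma inverse_lift_props:
  fixes z :: "complex ^ 'n::finite option"
  assumes "qform z \<noteq> 0" "unphase i z \<noteq> 0"
  shows "inverse_lift i z \<in> disc_lift" "disc_map (tangent_pr (inverse_lift i z)) = line z"
proof -
  define x y where "x = (\<chi> j. Re (real_phase i z $ j))" and "y = (\<chi> j. Im (real_phase i z $ j))"
  have xy: "real_phase i z = cplx x y" by (simp add: cplx_def x_def y_def vec_eq_iff)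
  have k: "(cmod (unphase i z))\<^sup>2 * cmod (qform z) > 0" using assms by simp
  have "Complex (x \<bullet> x - y \<bullet> y) (2 * (x \<bullet> y)) = complex_of_real ((cmod (unphase i z))\<^sup>2 * cmod (qform z))"
    using qform_real_phase[OF assms(1), of i] unfolding xy qform_cplx .
  then have o: "x \<bullet> y = 0" and l: "y \<bullet> y < x \<bullet> x" using k by (auto simp: complex_eq_iff)
  have il: "inverse_lift i z = (x, - ((x \<bullet> x) / (x \<bullet> x + y \<bullet> y)) *\<^sub>R y)"
    by (simp add: inverse_lift_def x_def y_def Let_def)
  note p = polar_lift_of_cplx[OF o l, folded il]
  show "inverse_lift i z \<in> disc_lift" by (rule p(1))
  have z0: "z \<noteq> 0" using assms(1) by (auto simp: qform_def)
  have nz: "cplx x y \<noteq> 0" using z0 assms(2) unfolding xy[symmetric] real_phase_def by simp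
  have "disc_map (tangent_pr (inverse_lift i z)) = line (complex_of_real (inverse (norm (cplx x y))) *s cplx x y)"
    unfolding disc_map_lift(2)[OF p(1)] p(2) ..
  also have "\<dots> = line (cplx x y)" using nz by (intro line_scale) simp
  also have "\<dots> = line z" unfolding xy[symmetric] real_phase_def by (rule line_scale[OF assms(2)])
  finally show "disc_map (tangent_pr (inverse_lift i z)) = line z" .
qed

lemma smooth_on_unphase: "smooth_on {z :: complex ^ 'm::finite. qform z \<noteq> 0} (unphase i)"
proof -
  have q: "smooth_on {z :: complex ^ 'm. qform z \<noteq> 0} qform"
    by (rule smooth_on_subset[OF smooth_on_qform]) simp
  show ?thesis
    unfolding unphase_def[abs_def] norm_eq_sqrt_inner
    by (intro smooth_on_add smooth_on_mult smooth_on_divide smooth_on_linear_compose[OF _ bounded_linear_cnj]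
      smooth_on_linear_compose[OF _ bounded_linear_of_real] smooth_on_sqrt smooth_on_inner
      smooth_on_vec_nth smooth_on_ident q open_qform_nonzero) auto
qed

lemma open_unphase: "open {z :: complex ^ 'm::finite. qform z \<noteq> 0 \<and> unphase i z \<noteq> 0}"
proof -
  have "open ({z :: complex ^ 'm. qform z \<noteq> 0} \<inter> unphase i -` (- {0}))"
    by (rule continuous_open_preimage[OF smooth_on_imp_continuous_on[OF smooth_on_unphase] open_qform_nonzero]) auto
  moreover have "{z. qform z \<noteq> 0} \<inter> unphase i -` (- {0}) = {z :: complex ^ 'm. qform z \<noteq> 0 \<and> unphase i z \<noteq> 0}"
    by blast
  ultimately show ?thesis by simp
qed

lemma smooth_on_inverse_lift:
  "smooth_on {z :: complex ^ 'n::finite option. qform z \<noteq> 0 \<and> unphase i z \<noteq> 0} (inverse_lift i)"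
proof -
  let ?W = "{z :: complex ^ 'n option. qform z \<noteq> 0 \<and> unphase i z \<noteq> 0}"
  let ?x = "\<lambda>z :: complex ^ 'n option. \<chi> j. Re (real_phase i z $ j)"
  let ?y = "\<lambda>z :: complex ^ 'n option. \<chi> j. Im (real_phase i z $ j)"
  have u: "smooth_on ?W (unphase i)" by (rule smooth_on_subset[OF smooth_on_unphase]) auto
  have p: "smooth_on ?W (\<lambda>z. real_phase i z $ j)" for j
    unfolding real_phase_def vector_smult_component
    by (intro smooth_on_mult u smooth_on_vec_nth smooth_on_ident open_unphase)
  have x: "smooth_on ?W ?x" and y: "smooth_on ?W ?y"
    by (intro smooth_on_vec open_unphase smooth_on_linear_compose[OF _ bounded_linear_Re]
      smooth_on_linear_compose[OF _ bounded_linear_Im] p)+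
  have nz: "?x z \<bullet> ?x z + ?y z \<bullet> ?y z \<noteq> 0" if "z \<in> ?W" for z
  proof -
    have "fst (inverse_lift i z) \<noteq> 0"
      using inverse_lift_props(1)[of z i] that by (auto simp: disc_lift_def)
    then have "?x z \<bullet> ?x z > 0" by (simp add: inverse_lift_def Let_def)
    then show ?thesis by (smt (verit) inner_ge_zero)
  qed
  have "smooth_on ?W (\<lambda>z. (?x z, - ((?x z \<bullet> ?x z) / (?x z \<bullet> ?x z + ?y z \<bullet> ?y z)) *\<^sub>R ?y z))"
    by (intro smooth_on_Pair smooth_on_scaleR smooth_on_minus smooth_on_divide smooth_on_add smooth_on_inner x y
        open_unphase nz)
  then show ?thesis by (simp add: inverse_lift_def[abs_def] Let_def)
qed

lemma disc_map_image: "disc_map ` points disc_RP = points CQ"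
proof
  show "disc_map ` points disc_RP \<subseteq> points CQ"
    using smooth_map_disc_map by (auto simp: smooth_map_def)
  show "points CQ \<subseteq> disc_map ` points disc_RP"
  proof
    fix p :: "(complex ^ 'n::finite option) set" assume "p \<in> points CQ"
    then obtain z where z: "qform z \<noteq> 0" "p = line z"
      unfolding smooth_cover.pr_image[OF CQ_cover, symmetric] by auto
    obtain i where "unphase i z \<noteq> 0" using unphase_nonzero[OF z(1)] .
    from inverse_lift_props[OF z(1) this] show "p \<in> disc_map ` points disc_RP"
      using smooth_cover.in_points[OF disc_RP_cover] z(2) by (metis image_eqI)
  qed
qed

lemma smooth_map_disc_map_inverse: "smooth_map CQ disc_RP (inv_into (points disc_RP) disc_map)"
proof (rule smooth_mapI[OF CQ_cover disc_RP_cover])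
  fix z :: "complex ^ 'n::finite option" assume "z \<in> {z. qform z \<noteq> 0}"
  then have z: "qform z \<noteq> 0" by simp
  obtain i where i: "unphase i z \<noteq> 0" using unphase_nonzero[OF z] .
  let ?W = "{z :: complex ^ 'n option. qform z \<noteq> 0 \<and> unphase i z \<noteq> 0}"
  have "inv_into (points disc_RP) disc_map (line y) = tangent_pr (inverse_lift i y)" if "y \<in> ?W" for y
  proof (rule inv_into_f_eq[OF inj_on_disc_map])
    have y: "qform y \<noteq> 0" "unphase i y \<noteq> 0" using that by auto
    show "tangent_pr (inverse_lift i y) \<in> points disc_RP"
      by (rule smooth_cover.in_points[OF disc_RP_cover inverse_lift_props(1)[OF y]])
    show "disc_map (tangent_pr (inverse_lift i y)) = line y"
      by (rule inverse_lift_props(2)[OF y])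
  qed
  then show "\<exists>W h. open W \<and> z \<in> W \<and> W \<subseteq> {z. qform z \<noteq> 0} \<and> smooth_on W h \<and> h ` W \<subseteq> disc_lift \<and>
      (\<forall>y\<in>W. inv_into (points disc_RP) disc_map (line y) = tangent_pr (h y))"
    using z i inverse_lift_props(1)
    by (intro exI[of _ ?W] exI[of _ "inverse_lift i"] conjI open_unphase smooth_on_inverse_lift) auto
qed

section \<open>Equivariance\<close>

lemma act_CP_line: "act_CP A (line z) = line (map_matrix complex_of_real A *v z)"
  unfolding act_CP_def line_def' by (auto simp: matrix_vector_mult_scaleR image_image vector_scalar_commute)

lemma act_RP_line: "act_RP A (line x) = line (A *v x)"
  unfolding act_RP_def line_def' by (auto simp: image_image vector_scalar_commute)

lemma map_matrix_cplx: "map_matrix complex_of_real A *v cplx a b = cplx (A *v a) (A *v b)"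
  by (simp add: cplx_def matrix_vector_mult_def map_matrix_def vec_eq_iff complex_eq_iff)

lemma polar_lift_orthogonal:
  assumes "orthogonal_transformation (\<lambda>x. A *v x)"
  shows "polar_lift (A *v fst z, A *v snd z) = map_matrix complex_of_real A *v polar_lift z"
proof -
  have i: "(A *v x) \<bullet> (A *v y) = x \<bullet> y" and n: "norm (A *v x) = norm x" for x y
    using assms by (auto simp: orthogonal_transformation_def orthogonal_transformation_norm)
  have h: "dsgn (A *v x) (A *v u) = A *v dsgn x u" for x u
    by (simp add: dsgn_def n i matrix_vector_mult_diff_distrib matrix_vector_mult_scaleR)
  show ?thesis
    by (simp add: polar_lift_def lift_rad_def h i n map_matrix_cplx sgn_div_norm matrix_vector_mult_scaleR
      flip: scaleR_minus_left)
qed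

lemma disc_map_equivariant:
  assumes A: "rotation_matrix A" and y: "y \<in> points disc_RP"
  shows "disc_map (act_TRP A y) = act_CP A (disc_map y)"
proof -
  obtain z where z: "z \<in> disc_lift" "y = tangent_pr z"
    using y smooth_cover.pr_image[OF disc_RP_cover] by blast
  have x: "fst z \<noteq> 0" using z by (simp add: disc_lift_def)
  have o: "orthogonal_transformation (\<lambda>x. A *v x)"
    using A by (simp add: rotation_matrix_def orthogonal_transformation_matrix)
  have nz: "A *v x \<noteq> 0" if "x \<noteq> 0" for x
    using that orthogonal_transformation_norm[OF o, of x] by (metis norm_eq_zero)
  have lin: "bounded_linear (\<lambda>x. A *v x)"
    by (rule matrix_vector_mul_bounded_linear)
  have "differential RP RP (act_RP A) (line (fst z)) (lpush (fst z) (snd z)) = lpush (A *v fst z) (A *v snd z)"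
    by (rule differential_push_global[OF proj_cover proj_cover, of "\<lambda>x. A *v x"])
      (use x nz in \<open>auto simp: act_RP_line bounded_linear_imp_has_derivative lin intro: smooth_on_linear lin\<close>)
  then have "act_TRP A y = tangent_pr (A *v fst z, A *v snd z)"
    by (simp add: z act_TRP_def tangent_pr_def act_RP_line)
  then show ?thesis
    using x nz polar_lift_orthogonal[OF o, of z]
    by (simp add: z disc_map_tangent_pr act_CP_line)
qed

theorem theorem4:
  fixes c :: real and k :: "'n::finite"
  assumes normalized: "line_area (fs_form c) k = 4 * pi"
  defines "g \<equiv> (RP_metric c :: ((real ^ 'n option) set, 'n option, real ^ 'n) two_tensor)"
  defines "D1RP \<equiv> unit_disc_bundle RP g"
  shows "\<exists>F. symplectomorphism
               D1RP (ext_deriv D1RP (canonical_one_form RP g))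
               (restrict_mfd CP (- quadric)) (fs_form c) F \<and>
             (\<forall>A. rotation_matrix A \<longrightarrow>
               (\<forall>y \<in> points D1RP. F (act_TRP A y) = act_CP A (F y)))"
proof -
  have c: "c = 4" using normalized by (simp add: line_area_fs_form)
  have "diffeomorphism (unit_disc_bundle RP (RP_metric 4)) (CQ :: ((complex ^ 'n option) set, _, _) mfd) disc_map"
    unfolding diffeomorphism_def bij_betw_def
    using inj_on_disc_map disc_map_image smooth_map_disc_map smooth_map_disc_map_inverse by blast
  then show ?thesis
    unfolding D1RP_def g_def c symplectomorphism_def
    by (intro exI[of _ disc_map] conjI ballI allI impI disc_map_symplectic disc_map_equivariant)
qed

end
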